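(* Let $X$ be a CAT(0) space with basepoint $\mathfrak{o}$, let $\widehat{X}=(X,\hat d)$ be its curtain model, and let $\kappa$ be a sublinear function. Let $b$ be a geodesic ray in $X$ emanating from $\mathfrak{o}$ with infinite diameter in $\widehat{X}$. \begin{itemize} \item If $b$ is $\kappa$-contracting and $\kappa^4$ is sublinear, then $b$ has a $\kappa^4$-persistent shadow in the $\hat d$ metric. \item If $b$ has a $\kappa$-persistent shadow in the $\hat d$ metric and $\kappa^2$ is sublinear, then $b$ is $\kappa^2$-contracting. \end{itemize}
   Context: **Sublinear functions.** A sublinear function is $\kappa:[0,\infty)\to[1,\infty)$ with $\lim_{t\to\infty}\kappa(t)/t=0$; by convention $\kappa$ is monotone increasing (constants allowed) and concave. "$\kappa^p$ is sublinear" means $\lim_{t\to\infty}\kappa(t)^p/t=0$. For a function $f$ on $[0,\infty)$ and $x\in X$, $f(x):=f(d(\mathfrak{o},x))$. **$f$-contracting and $f$-persistent shadow** (used for $f=\kappa,\kappa^2,\kappa^4$). With $\pi_b$ the closest point projection to $b$, the geodesic ray $b$ is $f$-contracting if there is $C\ge0$ such that for every $x\in X$ and every ball $B$ centered at $x$ with $B\cap b=\emptyset$ one has $\operatorname{diam}(\pi_b(B))<C f(x)$. The ray $b$ (of infinite diameter in $\widehat{X}$) has an $f$-persistent shadow if there is $C>0$ such that for all $s<t$, $\hat d(b(s),b(t))\ge C\cdot\frac{t-s}{f(t)}-C$. **Curtains.** Let $a:I\to X$ be a geodesic, $\pi_a$ the closest point projection to $a$, and $r$ a number with $[r-\frac12,r+\frac12]$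 in the interior of $I$. The curtain dual to $a$ at $r$ is $h=h_{a,r}=\pi_a^{-1}(a([r-\frac12,r+\frac12]))$; its half spaces $h^-$ and $h^+$ are the preimages under $\pi_a$ of the parts of $a$ before $r-\frac12$ and after $r+\frac12$. A curtain $h$ separates $A,B\subset X$ if one of $A,B$ lies in $h^-$ and the other in $h^+$. A set $\{h_i\}$ of curtains is a chain if the $h_i$ are pairwise disjoint and $h_i$ separates $h_{i-1}$ from $h_{i+1}$ for all $i$; it separates $A$ from $B$ if every $h_i$ does. A chain meets a set if each of its curtains intersects it. Disjoint curtains $h,h'$ are $L$-separated if every chain meeting both has cardinality at most $L$. An $L$-chain is a chain whose curtains are pairwise $L$-separated. **Curtain model.** For $L\in\mathbb{N}$, $L\ge1$, set $d_L(x,x)=0$ and, for $x\ne y$, $d_L(x,y)=1+\max\{|c|: c\text{ is an }L\text{-chain separating }x\text{ from }y\}$. The curtain model is $\widehat{X}=(X,\hat d)$ with $\hat d(x,y)=\sum_{L=1}^\infty \frac{d_L(x,y)}{L^3}$. *)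

theory Defs
  imports "HOL-Analysis.Analysis"
begin

definition geodesic_on :: "real set \<Rightarrow> (real \<Rightarrow> 'a::metric_space) \<Rightarrow> bool" where
  "geodesic_on I a \<longleftrightarrow> (\<forall>s\<in>I. \<forall>t\<in>I. dist (a s) (a t) = \<bar>s - t\<bar>)"

definition geodesic_segment :: "'a::metric_space \<Rightarrow> 'a \<Rightarrow> 'a set \<Rightarrow> bool" where
  "geodesic_segment x y S \<longleftrightarrow>
     (\<exists>a. geodesic_on {0..dist x y} a \<and> a 0 = x \<and> a (dist x y) = y \<and> S = a ` {0..dist x y})"

(* The inequality compares points p, q on two sides of a geodesic triangle x y z that share the
   vertex x; since x, y, z are arbitrary this covers every pair of sides. The third side exists
   by the first conjunct and does not enter the inequality. Two points on one side satisfy it with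
   equality. The primed points are the comparison triangle and the comparison points in the
   Euclidean plane. *)
definition CAT0_space :: "'a::metric_space itself \<Rightarrow> bool" where
  "CAT0_space _ \<longleftrightarrow>
     (\<forall>x y :: 'a. \<exists>S. geodesic_segment x y S) \<and>
     (\<forall>(x::'a) y z S T (x' :: real^2) y' z'.
        geodesic_segment x y S \<longrightarrow> geodesic_segment x z T \<longrightarrow>
        dist x' y' = dist x y \<longrightarrow> dist x' z' = dist x z \<longrightarrow> dist y' z' = dist y z \<longrightarrow>
        (\<forall>p\<in>S. \<forall>q\<in>T. \<forall>p'\<in>closed_segment x' y'. \<forall>q'\<in>closed_segment x' z'.
           dist x' p' = dist x p \<longrightarrow> dist x' q' = dist x q \<longrightarrow> dist p q \<le> dist p' q'))"

(* The library's closest_point is restricted to real inner product spaces. In a CAT(0) space the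
   closest point of the image of a geodesic with closed domain exists and is unique. *)
definition closest_proj :: "'a::metric_space set \<Rightarrow> 'a \<Rightarrow> 'a" where
  "closest_proj S x = (THE p. p \<in> S \<and> (\<forall>q\<in>S. dist x p \<le> dist x q))"

(* h is a curtain with half spaces hm (before) and hp (after). *)
definition curtain_halves :: "'a::metric_space set \<Rightarrow> 'a set \<Rightarrow> 'a set \<Rightarrow> bool" where
  "curtain_halves h hm hp \<longleftrightarrow>
     (\<exists>I a r. is_interval I \<and> closed I \<and> geodesic_on I a \<and>
        {r - 1/2..r + 1/2} \<subseteq> interior I \<and>
        h = closest_proj (a ` I) -` a ` {r - 1/2..r + 1/2} \<and>
        hm = closest_proj (a ` I) -` a ` (I \<inter> {..<r - 1/2}) \<and>
        hp = closest_proj (a ` I) -` a ` (I \<inter> {r + 1/2<..}))"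

definition curtain :: "'a::metric_space set \<Rightarrow> bool" where
  "curtain h \<longleftrightarrow> (\<exists>hm hp. curtain_halves h hm hp)"

(* Curtains are plain sets. In a CAT(0) space the half spaces are the two connected components of
   the complement of h, so up to exchanging them they do not depend on the dual geodesic. *)
definition curtain_separates :: "'a::metric_space set \<Rightarrow> 'a set \<Rightarrow> 'a set \<Rightarrow> bool" where
  "curtain_separates h A B \<longleftrightarrow>
     (\<exists>hm hp. curtain_halves h hm hp \<and> (A \<subseteq> hm \<and> B \<subseteq> hp \<or> B \<subseteq> hm \<and> A \<subseteq> hp))"

(* A chain is indexed by a finite or infinite set J of consecutive integers; J may be empty.
   Since curtains are nonempty, the disjointness makes the indexing injective. *)
definition curtain_chain :: "'a::metric_space set set \<Rightarrow> bool" where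
  "curtain_chain c \<longleftrightarrow>
     (\<exists>(J::int set) h. (\<forall>i\<in>J. \<forall>j\<in>J. {i..j} \<subseteq> J) \<and> c = h ` J \<and>
        (\<forall>i\<in>J. curtain (h i)) \<and> disjoint_family_on h J \<and>
        (\<forall>i. i - 1 \<in> J \<and> i \<in> J \<and> i + 1 \<in> J \<longrightarrow>
           curtain_separates (h i) (h (i - 1)) (h (i + 1))))"

definition chain_separates :: "'a::metric_space set set \<Rightarrow> 'a set \<Rightarrow> 'a set \<Rightarrow> bool" where
  "chain_separates c A B \<longleftrightarrow> (\<forall>h\<in>c. curtain_separates h A B)"

definition chain_meets :: "'a set set \<Rightarrow> 'a set \<Rightarrow> bool" where
  "chain_meets c A \<longleftrightarrow> (\<forall>h\<in>c. h \<inter> A \<noteq> {})"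

definition L_separated :: "nat \<Rightarrow> 'a::metric_space set \<Rightarrow> 'a set \<Rightarrow> bool" where
  "L_separated L h h' \<longleftrightarrow> h \<inter> h' = {} \<and>
     (\<forall>c. curtain_chain c \<and> chain_meets c h \<and> chain_meets c h' \<longrightarrow> finite c \<and> card c \<le> L)"

definition L_chain :: "nat \<Rightarrow> 'a::metric_space set set \<Rightarrow> bool" where
  "L_chain L c \<longleftrightarrow> curtain_chain c \<and> (\<forall>h\<in>c. \<forall>h'\<in>c. h \<noteq> h' \<longrightarrow> L_separated L h h')"

(* In a CAT(0) space the maximum exists: disjoint curtains separating x from y cut disjoint
   subsets, each of length at least 1, out of a geodesic from x to y, so there are at most
   dist x y of them. The empty chain contributes 0. *)
definition L_dist :: "nat \<Rightarrow> 'a::metric_space \<Rightarrow> 'a \<Rightarrow> nat" where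
  "L_dist L x y =
     (if x = y then 0 else 1 + Max {card c | c. L_chain L c \<and> chain_separates c {x} {y}})"

definition dhat :: "'a::metric_space \<Rightarrow> 'a \<Rightarrow> real" where
  "dhat x y = (\<Sum>n. real (L_dist (Suc n) x y) / real (Suc n) ^ 3)"

definition sublinear_growth :: "(real \<Rightarrow> real) \<Rightarrow> bool" where
  "sublinear_growth f \<longleftrightarrow> ((\<lambda>t. f t / t) \<longlongrightarrow> 0) at_top"

(* Only the restriction of the function to the nonnegative reals matters. *)
definition sublinear_function :: "(real \<Rightarrow> real) \<Rightarrow> bool" where
  "sublinear_function \<kappa> \<longleftrightarrow>
     (\<forall>t\<ge>0. \<kappa> t \<ge> 1) \<and> mono_on {0..} \<kappa> \<and> concave_on {0..} \<kappa> \<and> sublinear_growth \<kappa>"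

definition geodesic_ray_from :: "'a::metric_space \<Rightarrow> (real \<Rightarrow> 'a) \<Rightarrow> bool" where
  "geodesic_ray_from \<oo> b \<longleftrightarrow> geodesic_on {0..} b \<and> b 0 = \<oo>"

definition dhat_infinite_diameter :: "'a::metric_space set \<Rightarrow> bool" where
  "dhat_infinite_diameter S \<longleftrightarrow> \<not> bdd_above ((\<lambda>(x, y). dhat x y) ` (S \<times> S))"

definition contracting_ray ::
    "'a::metric_space \<Rightarrow> (real \<Rightarrow> real) \<Rightarrow> (real \<Rightarrow> 'a) \<Rightarrow> bool" where
  "contracting_ray \<oo> f b \<longleftrightarrow>
     (\<exists>C\<ge>0. \<forall>x. \<forall>R>0. ball x R \<inter> b ` {0..} = {} \<longrightarrow>
        diameter (closest_proj (b ` {0..}) ` ball x R) < C * f (dist \<oo> x))"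

definition persistent_shadow :: "(real \<Rightarrow> real) \<Rightarrow> (real \<Rightarrow> 'a::metric_space) \<Rightarrow> bool" where
  "persistent_shadow f b \<longleftrightarrow>
     (\<exists>C>0. \<forall>s t. 0 \<le> s \<and> s < t \<longrightarrow> dhat (b s) (b t) \<ge> C * ((t - s) / f t) - C)"

end

(* Contracting implies persistent shadow. If a curtain k meets two curtains dual to b that are far
   apart, then k contains a geodesic whose endpoints have distant projections to b. By contraction
   such a geodesic comes within distance of order kappa(t) of b, so all curtains of a chain meeting
   both dual curtains meet a common set of diameter of order kappa(t), and their number is bounded by
   that diameter.

   Persistent shadow implies contracting. Since d_L(b(s), b(t)) <= 1 + (t - s), the terms with
   L > L0 contribute at most (t - s) / L0 to dhat up to a constant; for L0 of order kappa(t) the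
   persistent shadow therefore forces an L0-chain of order (t - s) / kappa(t) curtains separating b(s)
   from b(t). If b(s) and b(t) are the projections of x and y with d(x, y) < d(x, b), then each of
   these curtains crosses [b(s), x], [x, y] or [y, b(t)], and L0-separation allows only of order L0
   crossings of each of the three; hence t - s is at most of order kappa(t)^2. *)
theory Submission
  imports Defs
begin

section \<open>Geodesics in CAT(0) spaces\<close>

text \<open>For the first implication there are two obstacles. The contraction bound at x is of
  order \<kappa>(d(o,x)), and x may be far beyond b(t). So projection is taken to a short segment
  [r, r+G] of b, for which d(o,x) is at most t plus the height of x; the bound becomes a function E
  of the height alone. A geodesic displaced by 2R along the segment must descend to height R once 7
  E(6R) < R, and sublinearity yields such an R = K \<kappa>(t) although R also occurs inside
  \<kappa>. Moreover curtains are not convex: two points of a curtain are joined in it only by two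
  segments and a jump of length at most 1, and one of these segments inherits a large displacement.

  For the second implication crossings are counted by a bridge: two L-separated curtains crossing
  the same two segments force these to come within L+1 of each other. A segment perpendicular to b,
  or inside a ball missing b, is that close to b only near one end, so few curtains are crossed
  before.

  Metric comparison enters only as Stewart's inequality.\<close>

lemma triangle_exists_plane:
  fixes l X Y :: real
  assumes "0 < l" "l \<le> X + Y" "X \<le> l + Y" "Y \<le> l + X"
  obtains x y z :: "real^2" where "dist x y = l" "dist x z = X" "dist y z = Y"
proof -
  \<comment> \<open>With the side of length \<open>l\<close> on the first axis, \<open>u\<close> is
    the abscissa of the third vertex by the law of cosines. The triangle inequalities give
    \<open>\<bar>u\<bar> \<le> X\<close>, so the vertex has a real ordinate.\<close>
  define u where "u = (X^2 + l^2 - Y^2) / (2 * l)"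
  have u: "2 * l * u = X^2 + l^2 - Y^2" using assms by (simp add: u_def)
  have X0: "0 \<le> X" "0 \<le> Y" using assms by auto
  have "2 * l * u \<le> 2 * l * X"
  proof -
    have "\<bar>l - X\<bar> \<le> Y" using assms by auto
    then have "(l - X)^2 \<le> Y^2" by (metis abs_ge_zero power2_abs power_mono)
    then show ?thesis unfolding u by (simp add: power2_eq_square algebra_simps)
  qed
  then have 1: "u \<le> X" using assms by simp
  have "2 * l * (- u) \<le> 2 * l * X"
  proof -
    have "Y^2 \<le> (l + X)^2" using assms X0 by (simp add: power_mono)
    then show ?thesis using u by (simp add: power2_eq_square algebra_simps)
  qed
  then have 2: "- u \<le> X" using assms by (metis mult_le_cancel_left_pos zero_less_mult_iff zero_less_numeral)
  have "u^2 \<le> X^2" using 1 2 by (intro power2_le_iff_abs_le[THEN iffD2]) (use X0 in auto)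
  then have w: "sqrt (X^2 - u^2) ^ 2 = X^2 - u^2" by simp
  have d: "dist x y = sqrt ((x$1 - y$1)^2 + (x$2 - y$2)^2)" for x y :: "real^2"
    by (simp add: dist_vec_def L2_set_def sum_2 dist_real_def)
  show thesis
  proof (rule that[of "vector [0,0]" "vector [l,0]" "vector [u, sqrt (X^2 - u^2)]"])
    show "dist (vector [0,0] :: real^2) (vector [l,0]) = l" using assms by (simp add: d)
    show "dist (vector [0,0] :: real^2) (vector [u, sqrt (X^2 - u^2)]) = X"
      using w X0 by (simp add: d)
    have "(l - u)^2 + (X^2 - u^2) = Y^2" using u by (simp add: power2_eq_square algebra_simps)
    then show "dist (vector [l,0] :: real^2) (vector [u, sqrt (X^2 - u^2)]) = Y"
      using w X0 by (simp add: d)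
  qed
qed

lemma stewart_euclidean:
  fixes x y z :: "'b::real_inner"
  shows "(dist z ((1 - r) *\<^sub>R x + r *\<^sub>R y))\<^sup>2
           = (1 - r) * (dist z x)\<^sup>2 + r * (dist z y)\<^sup>2 - r * (1 - r) * (dist x y)\<^sup>2"
  unfolding dist_norm power2_norm_eq_inner
  by (simp add: inner_diff_left inner_diff_right inner_add_left inner_add_right inner_commute algebra_simps)

text \<open>In a CAT(0) space the metric interval is the geodesic segment from \<open>x\<close> to \<open>y\<close>, so that
  \<open>gpt x y r\<close> is the only point satisfying its specification for \<open>r\<close> in \<open>[0, 1]\<close>.\<close>

definition mseg :: "'a::metric_space \<Rightarrow> 'a \<Rightarrow> 'a set" where
  "mseg x y = {p. dist x p + dist p y = dist x y}"

lemma mseg_commute: "mseg x y = mseg y x"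
  by (auto simp: mseg_def dist_commute)

lemma mseg_ends [simp]: "x \<in> mseg x y" "y \<in> mseg x y"
  by (auto simp: mseg_def)

definition gpt :: "'a::metric_space \<Rightarrow> 'a \<Rightarrow> real \<Rightarrow> 'a" where
  "gpt x y r = (SOME p. dist x p = r * dist x y \<and> dist p y = (1 - r) * dist x y)"

text \<open>The projection is recorded as a parameter rather than a point, so that curtains and half
  spaces become preimages of intervals under a real function.\<close>

definition gpar :: "(real \<Rightarrow> 'a::metric_space) \<Rightarrow> real set \<Rightarrow> 'a \<Rightarrow> real" where
  "gpar a I x = (THE \<tau>. \<tau> \<in> I \<and> (\<forall>\<sigma>\<in>I. dist x (a \<tau>) \<le> dist x (a \<sigma>)))"

locale cat0 =
  fixes X :: "'a::metric_space itself"
  assumes CAT0: "CAT0_space TYPE('a)"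
begin

lemma ex_geodesic:
  fixes x y :: 'a
  obtains a where "geodesic_on {0..dist x y} a" "a 0 = x" "a (dist x y) = y"
  using CAT0 unfolding CAT0_space_def geodesic_segment_def by metis

text \<open>The comparison axiom is applied to a point of [x, y] and the end point \<open>z\<close>
  of the side [x, z]; the rest is the Euclidean identity. Later estimates use this inequality in
  place of comparison triangles.\<close>

lemma stewart_on_geodesic:
  fixes a :: "real \<Rightarrow> 'a"
  assumes a: "geodesic_on {0..l} a" and l: "0 < l" and "0 \<le> r" "r \<le> 1"
  shows "(dist z (a (r * l)))\<^sup>2
           \<le> (1 - r) * (dist z (a 0))\<^sup>2 + r * (dist z (a l))\<^sup>2 - r * (1 - r) * l\<^sup>2"
proof -
  define x y p where "x = a 0" and "y = a l" and "p = a (r * l)"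
  have lam: "0 \<le> r * l" "r * l \<le> l" using assms by (auto simp: mult_left_le_one_le)
  have dxy: "dist x y = l" using a l by (simp add: x_def y_def geodesic_on_def)
  have dxp: "dist x p = r * l"
    using a l lam by (auto simp: x_def p_def geodesic_on_def)
  define S where "S = a ` {0..l}"
  have S: "geodesic_segment x y S" "p \<in> S"
    unfolding geodesic_segment_def S_def dxy using a lam by (auto simp: x_def y_def p_def)
  obtain T where T: "geodesic_segment x z T" using CAT0 unfolding CAT0_space_def by blast
  then have zT: "z \<in> T" unfolding geodesic_segment_def by (metis atLeastAtMost_iff imageI order_refl zero_le_dist)
  obtain x' y' z' :: "real^2" where d: "dist x' y' = l" "dist x' z' = dist x z" "dist y' z' = dist y z"
    using triangle_exists_plane[of l "dist x z" "dist y z"] l dxy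
      dist_triangle[of x y z] dist_triangle[of x z y] dist_triangle[of y z x] by (metis dist_commute)
  define p' where "p' = (1 - r) *\<^sub>R x' + r *\<^sub>R y'"
  have p': "p' \<in> closed_segment x' y'" using assms by (auto simp: p'_def closed_segment_def)
  have "p' - x' = r *\<^sub>R (y' - x')" by (simp add: p'_def algebra_simps)
  then have dp': "dist x' p' = dist x p"
    using assms d dxp by (metis abs_of_nonneg dist_commute dist_norm norm_scaleR)
  have "dist p z \<le> dist p' z'"
    using CAT0[unfolded CAT0_space_def, THEN conjunct2, rule_format, OF S(1) T _ d(2,3) S(2) zT p' _ dp', of z'] d(1) dxy d(2)
    by auto
  then have "(dist z p)\<^sup>2 \<le> (dist z' p')\<^sup>2" by (metis dist_commute power_mono zero_le_dist)
  also have "\<dots> = (1 - r) * (dist z x)\<^sup>2 + r * (dist z y)\<^sup>2 - r * (1 - r) * l\<^sup>2"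
    unfolding p'_def stewart_euclidean using d by (simp add: dist_commute)
  finally show ?thesis by (simp add: x_def y_def p_def)
qed

lemma ex_gpt:
  fixes x y :: 'a
  assumes "0 \<le> r" "r \<le> 1"
  shows "\<exists>p. dist x p = r * dist x y \<and> dist p y = (1 - r) * dist x y"
proof -
  obtain a where a: "geodesic_on {0..dist x y} a" "a 0 = x" "a (dist x y) = y" by (rule ex_geodesic)
  have lam: "0 \<le> r * dist x y" "r * dist x y \<le> dist x y" using assms by (auto simp: mult_left_le_one_le)
  have "dist (a 0) (a (r * dist x y)) = r * dist x y"
       "dist (a (r * dist x y)) (a (dist x y)) = dist x y - r * dist x y"
    using a(1) lam by (auto simp: geodesic_on_def)
  then show ?thesis using a by (auto simp: algebra_simps)
qed

lemma
  fixes x y :: 'a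
  assumes "0 \<le> r" "r \<le> 1"
  shows dist_gpt_left: "dist x (gpt x y r) = r * dist x y"
    and dist_gpt_right: "dist (gpt x y r) y = (1 - r) * dist x y"
  using someI_ex[OF ex_gpt[OF assms]] unfolding gpt_def by blast+

lemma stewart:
  fixes x y z p :: 'a
  assumes lam: "0 \<le> r" "r \<le> 1" and p: "dist x p = r * dist x y" "dist p y = (1 - r) * dist x y"
  shows "(dist z p)\<^sup>2 \<le> (1 - r) * (dist z x)\<^sup>2 + r * (dist z y)\<^sup>2 - r * (1 - r) * (dist x y)\<^sup>2"
proof (cases "x = y")
  case True
  then show ?thesis using p by (simp add: algebra_simps)
next
  case False
  obtain a where a: "geodesic_on {0..dist x y} a" "a 0 = x" "a (dist x y) = y" by (rule ex_geodesic)
  note s = stewart_on_geodesic[OF a(1) _ lam, unfolded a]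
  \<comment> \<open>For \<open>z = p\<close> the right-hand side of \<open>s\<close> is r(1-r)(r +
    (1-r) - 1) times a squared distance, hence 0: a point with the prescribed distances lies on the
    chosen geodesic.\<close>
  have "(dist p (a (r * dist x y)))\<^sup>2 \<le> 0"
    using s[of p] False p by (simp add: dist_commute power2_eq_square algebra_simps)
  then have "a (r * dist x y) = p" by simp
  then show ?thesis using s[of z] False by simp
qed

lemma gpt_unique:
  fixes x y p q :: 'a
  assumes lam: "0 \<le> r" "r \<le> 1" and p: "dist x p = r * dist x y" "dist p y = (1 - r) * dist x y"
    and q: "dist x q = r * dist x y" "dist q y = (1 - r) * dist x y"
  shows "p = q"
proof -
  have "(dist p q)\<^sup>2 \<le> 0"
    using stewart[OF lam q, of p] p by (simp add: dist_commute power2_eq_square algebra_simps)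
  then show ?thesis by simp
qed

lemma gpt_eqI:
  fixes x y p :: 'a
  assumes "0 \<le> r" "r \<le> 1" "dist x p = r * dist x y" "dist p y = (1 - r) * dist x y"
  shows "gpt x y r = p"
  using gpt_unique assms dist_gpt_left dist_gpt_right by metis

lemma gpt_0 [simp]: "gpt x y 0 = (x::'a)" and gpt_1 [simp]: "gpt x y 1 = (y::'a)"
  by (auto intro: gpt_eqI)

lemma stewart_gpt:
  fixes x y z :: 'a
  assumes "0 \<le> r" "r \<le> 1"
  shows "(dist z (gpt x y r))\<^sup>2
           \<le> (1 - r) * (dist z x)\<^sup>2 + r * (dist z y)\<^sup>2 - r * (1 - r) * (dist x y)\<^sup>2"
  using assms dist_gpt_left dist_gpt_right by (intro stewart) auto

lemma geodesic_gpt: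
  fixes a :: "real \<Rightarrow> 'a"
  assumes "geodesic_on I a" "s \<in> I" "t \<in> I" "0 \<le> r" "r \<le> 1" "s + r * (t - s) \<in> I"
  shows "gpt (a s) (a t) r = a (s + r * (t - s))"
proof (rule gpt_eqI)
  have 1: "dist (a s) (a t) = \<bar>s - t\<bar>" using assms by (simp add: geodesic_on_def)
  have "dist (a s) (a (s + r * (t - s))) = \<bar>s - (s + r * (t - s))\<bar>"
    using assms unfolding geodesic_on_def by blast
  also have "\<dots> = r * \<bar>s - t\<bar>" using assms by (simp add: abs_mult abs_minus_commute)
  finally show "dist (a s) (a (s + r * (t - s))) = r * dist (a s) (a t)" using 1 by simp
  have "dist (a (s + r * (t - s))) (a t) = \<bar>(s + r * (t - s)) - t\<bar>"
    using assms unfolding geodesic_on_def by blast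
  also have "(s + r * (t - s)) - t = (1 - r) * (s - t)" by (simp add: algebra_simps)
  also have "\<bar>(1 - r) * (s - t)\<bar> = (1 - r) * \<bar>s - t\<bar>" using assms by (simp add: abs_mult)
  finally show "dist (a (s + r * (t - s))) (a t) = (1 - r) * dist (a s) (a t)" using 1 by simp
qed (use assms in auto)

lemma dist_gpt_gpt:
  fixes x y :: 'a
  assumes "0 \<le> r" "r \<le> 1" "0 \<le> \<mu>" "\<mu> \<le> 1"
  shows "dist (gpt x y r) (gpt x y \<mu>) = \<bar>r - \<mu>\<bar> * dist x y"
proof -
  obtain a where a: "geodesic_on {0..dist x y} a" "a 0 = x" "a (dist x y) = y" by (rule ex_geodesic)
  have m: "0 \<le> \<nu> * dist x y" "\<nu> * dist x y \<le> dist x y" if "0 \<le> \<nu>" "\<nu> \<le> 1" for \<nu>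
    using that by (auto simp: mult_left_le_one_le)
  have "gpt x y \<nu> = a (\<nu> * dist x y)" if "0 \<le> \<nu>" "\<nu> \<le> 1" for \<nu>
    using geodesic_gpt[OF a(1), of 0 "dist x y" \<nu>] a that m by auto
  then show ?thesis
    using a(1) m assms by (simp add: geodesic_on_def abs_mult flip: left_diff_distrib)
qed

lemma geodesic_on_gpt:
  fixes x y :: 'a
  assumes "x \<noteq> y"
  shows "geodesic_on {0..dist x y} (\<lambda>s. gpt x y (s / dist x y))"
  using assms by (auto simp: geodesic_on_def dist_gpt_gpt abs_mult simp flip: diff_divide_distrib)

lemma continuous_on_gpt: "continuous_on {0..1} (gpt x (y::'a))"
proof (rule continuous_onI)
  fix s e :: real assume s: "s \<in> {0..1}" "0 < e"
  show "\<exists>d>0. \<forall>x'\<in>{0..1}. dist x' s < d \<longrightarrow> dist (gpt x y x') (gpt x y s) \<le> e"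
  proof (intro exI conjI ballI impI)
    show "0 < e / (dist x y + 1)" using s by (simp add: add_nonneg_pos)
    fix t :: real assume t: "t \<in> {0..1}" "dist t s < e / (dist x y + 1)"
    have "dist (gpt x y t) (gpt x y s) = \<bar>t - s\<bar> * dist x y" using s t by (simp add: dist_gpt_gpt)
    also have "\<dots> \<le> \<bar>t - s\<bar> * (dist x y + 1)" by (simp add: mult_left_mono)
    also have "\<dots> \<le> e" using t by (simp add: dist_real_def pos_less_divide_eq add_nonneg_pos)
    finally show "dist (gpt x y t) (gpt x y s) \<le> e" .
  qed
qed

lemma gpt_sub:
  fixes x y :: 'a
  assumes "0 \<le> s" "s \<le> 1" "0 \<le> t" "t \<le> 1" "0 \<le> r" "r \<le> 1"
  shows "gpt (gpt x y s) (gpt x y t) r = gpt x y (s + r * (t - s))"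
proof -
  have i: "0 \<le> s + r * (t - s)" "s + r * (t - s) \<le> 1"
  proof -
    have "s + r * (t - s) = (1 - r) * s + r * t" by (simp add: algebra_simps)
    then show "0 \<le> s + r * (t - s)" "s + r * (t - s) \<le> 1"
      using assms convex_bound_le[of s 1 t "1 - r" r] by auto
  qed
  have e: "s - (s + r * (t - s)) = r * (s - t)" "s + r * (t - s) - t = (1 - r) * (s - t)"
    by (auto simp: algebra_simps)
  show ?thesis
    by (rule gpt_eqI) (use assms i e in \<open>simp_all add: dist_gpt_gpt abs_mult\<close>)
qed

lemma mseg_eq: "mseg x (y::'a) = gpt x y ` {0..1}"
proof (intro set_eqI iffI)
  fix p assume p: "p \<in> mseg x y"
  show "p \<in> gpt x y ` {0..1}"
  proof (cases "x = y")
    case True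
    then have "p = x" using p by (simp add: mseg_def dist_commute)
    then show ?thesis using gpt_0[of x y] by (metis atLeastAtMost_iff imageI order_refl zero_le_one)
  next
    case False
    let ?l = "dist x p / dist x y"
    have 1: "0 \<le> ?l" "?l \<le> 1" using p False by (auto simp: mseg_def divide_le_eq_1)
      (smt (verit) zero_le_dist)
    have "gpt x y ?l = p"
      using 1 p False by (intro gpt_eqI) (auto simp: mseg_def left_diff_distrib)
    then show ?thesis using 1 by (metis atLeastAtMost_iff imageI)
  qed
next
  fix p assume "p \<in> gpt x y ` {0..1}"
  then show "p \<in> mseg x y"
    by (auto simp: mseg_def dist_gpt_left dist_gpt_right algebra_simps)
qed

lemma mseg_gpt:
  fixes x y :: 'a
  assumes "0 \<le> s" "s \<le> t" "t \<le> 1"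
  shows "mseg (gpt x y s) (gpt x y t) = gpt x y ` {s..t}"
proof -
  have "mseg (gpt x y s) (gpt x y t) = (\<lambda>r. gpt x y (s + r * (t - s))) ` {0..1}"
    unfolding mseg_eq using assms by (intro image_cong) (auto simp: gpt_sub)
  also have "\<dots> = gpt x y ` ((\<lambda>r. (t - s) * r + s) ` {0..1})"
    by (simp add: image_image algebra_simps)
  also have "(\<lambda>r. (t - s) * r + s) ` {0..1} = {s..t}"
    using assms by (subst image_affinity_atLeastAtMost) auto
  finally show ?thesis .
qed

lemma mseg_geodesic:
  fixes a :: "real \<Rightarrow> 'a"
  assumes "geodesic_on I a" "{s..t} \<subseteq> I" "s \<le> t"
  shows "mseg (a s) (a t) = a ` {s..t}"
proof -
  have i: "s + r * (t - s) \<in> {s..t}" if "0 \<le> r" "r \<le> 1" for r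
    using that assms(3) mult_left_le_one_le[of "t - s" r] by auto
  have "mseg (a s) (a t) = (\<lambda>r. a (s + r * (t - s))) ` {0..1}"
    unfolding mseg_eq using assms i by (intro image_cong) (auto intro!: geodesic_gpt[of I])
  also have "\<dots> = a ` ((\<lambda>r. (t - s) * r + s) ` {0..1})"
    by (simp add: image_image algebra_simps)
  also have "(\<lambda>r. (t - s) * r + s) ` {0..1} = {s..t}"
    using assms by (subst image_affinity_atLeastAtMost) auto
  finally show ?thesis .
qed

lemma mseg_convex:
  fixes x y :: 'a
  assumes "p \<in> mseg x y" "q \<in> mseg x y"
  shows "mseg p q \<subseteq> mseg x y"
proof -
  have *: "mseg (gpt x y s) (gpt x y t) \<subseteq> mseg x y" if "0 \<le> s" "s \<le> t" "t \<le> 1" for s t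
    using that by (subst mseg_gpt) (auto simp: mseg_eq)
  obtain s t where st: "p = gpt x y s" "q = gpt x y t" "0 \<le> s" "s \<le> 1" "0 \<le> t" "t \<le> 1"
    using assms by (auto simp: mseg_eq)
  then show ?thesis using *[of s t] *[of t s] mseg_commute[of p q] by (cases "s \<le> t") auto
qed

lemma connected_mseg: "connected (mseg x (y::'a))"
  unfolding mseg_eq by (intro connected_continuous_image continuous_on_gpt) simp

text \<open>The angle at a closest point is at least a right angle. If the inequality failed, moving
  a small fraction of the way from \<open>p\<close> to \<open>u\<close> would come strictly closer
  to \<open>z\<close>.\<close>

lemma proj_ineq:
  fixes z p u :: 'a
  assumes "\<And>w. w \<in> mseg p u \<Longrightarrow> dist z p \<le> dist z w"
  shows "(dist z p)\<^sup>2 + (dist p u)\<^sup>2 \<le> (dist z u)\<^sup>2"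
proof (rule ccontr)
  define D where "D = (dist z p)\<^sup>2 + (dist p u)\<^sup>2 - (dist z u)\<^sup>2"
  assume "\<not> ?thesis"
  then have D: "0 < D" by (simp add: D_def)
  \<comment> \<open>Small enough for \<open>r * (dist p u)\<^sup>2 < D\<close>; the added 1 keeps
    the denominator positive when \<open>p = u\<close>.\<close>
  define r where "r = min 1 (D / (2 * ((dist p u)\<^sup>2 + 1)))"
  have q: "0 < (dist p u)\<^sup>2 + 1" by (simp add: add_nonneg_pos)
  have lam: "0 < r" "r \<le> 1" using D q by (auto simp: r_def)
  have "r * (2 * ((dist p u)\<^sup>2 + 1)) \<le> D"
    using q mult_right_mono[of r "D / (2 * ((dist p u)\<^sup>2 + 1))" "2 * ((dist p u)\<^sup>2 + 1)"]
    by (simp add: r_def)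
  then have lD: "r * (dist p u)\<^sup>2 < D" using lam D q
    by (smt (verit, best) mult_less_cancel_left_pos zero_le_power2 mult_nonneg_nonneg)
  have "gpt p u r \<in> mseg p u" using lam by (auto simp: mseg_eq)
  then have "(dist z p)\<^sup>2 \<le> (dist z (gpt p u r))\<^sup>2" using assms by (simp add: power_mono)
  also have "\<dots> \<le> (1 - r) * (dist z p)\<^sup>2 + r * (dist z u)\<^sup>2 - r * (1 - r) * (dist p u)\<^sup>2"
    using lam by (intro stewart_gpt) auto
  finally have "0 \<le> r * (r * (dist p u)\<^sup>2 - D)" by (simp add: D_def algebra_simps)
  then show False using lam lD by (simp add: zero_le_mult_iff)
qed

text \<open>The quadrilateral is \<open>x p q y\<close> with diagonals [x, q] and [y, p]. Stewart's
  inequality bounds the distances from a point \<open>m\<close> of the first diagonal to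
  \<open>p\<close> and \<open>y\<close>, and the second diagonal is at most their sum.\<close>

lemma quadrilateral:
  fixes p q x y :: 'a
  shows "(dist x q)\<^sup>2 + (dist y p)\<^sup>2 \<le> (dist x p)\<^sup>2 + (dist y q)\<^sup>2 + 2 * dist p q * dist x y"
proof (cases "p = q \<or> x = y")
  case True
  then show ?thesis by auto
next
  case False
  define B E where "B = dist p q" and "E = dist x y"
  have BE: "0 < B" "0 < E" using False by (auto simp: B_def E_def)
  \<comment> \<open>This ratio gives \<open>l * B = (1 - l) * E\<close>, so that the sum of the two
    squares equals twice their mixed product.\<close>
  define l where "l = E / (B + E)"
  have l: "0 < l" "l < 1" "l * (B + E) = E" "(1 - l) * (B + E) = B"
    using BE by (auto simp: l_def field_simps)
  define m where "m = gpt x q l"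
  have 1: "(dist p m)\<^sup>2 \<le> (1 - l) * (dist p x)\<^sup>2 + l * B\<^sup>2 - l * (1 - l) * (dist x q)\<^sup>2"
    unfolding m_def B_def using l by (intro stewart_gpt) auto
  have 2: "(dist y m)\<^sup>2 \<le> (1 - l) * E\<^sup>2 + l * (dist y q)\<^sup>2 - l * (1 - l) * (dist x q)\<^sup>2"
    unfolding m_def E_def dist_commute[of x y] using l by (intro stewart_gpt) auto
  have "(dist y p)\<^sup>2 \<le> (dist p m + dist y m)\<^sup>2"
    using dist_triangle[of y p m] by (intro power_mono) (auto simp: dist_commute)
  then have "l * (1 - l) * (dist y p)\<^sup>2 \<le> l * (1 - l) * (dist p m + dist y m)\<^sup>2"
    using l by (intro mult_left_mono) auto
  also have "\<dots> \<le> l * (dist p m)\<^sup>2 + (1 - l) * (dist y m)\<^sup>2"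
  proof -
    have "l * (dist p m)\<^sup>2 + (1 - l) * (dist y m)\<^sup>2 - l * (1 - l) * (dist p m + dist y m)\<^sup>2
        = (l * dist p m - (1 - l) * dist y m)\<^sup>2"
      by (simp add: power2_eq_square algebra_simps)
    then show ?thesis by (smt (verit) zero_le_power2)
  qed
  also have "\<dots> \<le> l * ((1 - l) * (dist p x)\<^sup>2 + l * B\<^sup>2 - l * (1 - l) * (dist x q)\<^sup>2)
      + (1 - l) * ((1 - l) * E\<^sup>2 + l * (dist y q)\<^sup>2 - l * (1 - l) * (dist x q)\<^sup>2)"
    using 1 2 l by (intro add_mono mult_left_mono) auto
  also have "\<dots> = l * (1 - l) * ((dist p x)\<^sup>2 + (dist y q)\<^sup>2 - (dist x q)\<^sup>2) + ((l * B)\<^sup>2 + ((1 - l) * E)\<^sup>2)"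
    by (simp add: power2_eq_square algebra_simps)
  also have "(l * B)\<^sup>2 + ((1 - l) * E)\<^sup>2 = l * (1 - l) * (2 * B * E)"
  proof -
    have "l * B = (1 - l) * E" using BE by (simp add: l_def field_simps)
    then show ?thesis by (simp add: power2_eq_square)
  qed
  finally have "l * (1 - l) * (dist y p)\<^sup>2
      \<le> l * (1 - l) * ((dist p x)\<^sup>2 + (dist y q)\<^sup>2 - (dist x q)\<^sup>2 + 2 * B * E)"
    by (simp add: algebra_simps)
  then have "(dist y p)\<^sup>2 \<le> (dist p x)\<^sup>2 + (dist y q)\<^sup>2 - (dist x q)\<^sup>2 + 2 * B * E"
    using l by (simp add: mult_le_cancel_left_pos)
  then show ?thesis by (simp add: B_def E_def dist_commute)
qed

text \<open>Stewart's inequality along [o', y] seen from \<open>?p\<close>, then along [o', x] seen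
  from \<open>y\<close>, bounds the squared chord by its Euclidean value
  \<open>s * t * ((dist x y)\<^sup>2 - (A - B)\<^sup>2)\<close>.\<close>

lemma chord:
  fixes o' x y :: 'a
  assumes "x \<noteq> o'" "y \<noteq> o'" "0 \<le> D" "D \<le> dist o' x" "D \<le> dist o' y"
  shows "dist (gpt o' x (D / dist o' x)) (gpt o' y (D / dist o' y)) \<le> dist x y"
proof -
  define A B s t where "A = dist o' x" and "B = dist o' y" and "s = D / A" and "t = D / B"
  have AB: "0 < A" "0 < B" using assms by (auto simp: A_def B_def)
  have st: "0 \<le> s" "s \<le> 1" "0 \<le> t" "t \<le> 1" "s * A = D" "t * B = D"
    using assms AB by (auto simp: s_def t_def divide_le_eq_1 A_def[symmetric] B_def[symmetric])
  let ?p = "gpt o' x s" and ?q = "gpt o' y t"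
  have 1: "(dist ?p ?q)\<^sup>2 \<le> (1 - t) * (dist ?p o')\<^sup>2 + t * (dist ?p y)\<^sup>2 - t * (1 - t) * B\<^sup>2"
    unfolding B_def using st by (intro stewart_gpt) auto
  have 2: "(dist y ?p)\<^sup>2 \<le> (1 - s) * (dist y o')\<^sup>2 + s * (dist y x)\<^sup>2 - s * (1 - s) * A\<^sup>2"
    unfolding A_def using st by (intro stewart_gpt) auto
  have 3: "dist ?p o' = D" using dist_gpt_left[of s o' x] st by (simp add: dist_commute A_def)
  have "(dist ?p ?q)\<^sup>2 \<le> (1 - t) * D\<^sup>2 + t * ((1 - s) * B\<^sup>2 + s * (dist x y)\<^sup>2 - s * (1 - s) * A\<^sup>2) - t * (1 - t) * B\<^sup>2"
    using 1 mult_left_mono[OF 2 st(3)] 3 by (simp add: dist_commute B_def)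
  also have "\<dots> = s * t * ((dist x y)\<^sup>2 - (A - B)\<^sup>2) + (D - t * B)\<^sup>2
      + 2 * t * B * (D - s * A) + t * (s * A + D) * (s * A - D)"
    by (simp add: power2_eq_square algebra_simps)
  also have "\<dots> = s * t * ((dist x y)\<^sup>2 - (A - B)\<^sup>2)" using st by simp
  also have "\<dots> \<le> s * t * (dist x y)\<^sup>2" using st by (intro mult_left_mono) auto
  also have "\<dots> \<le> 1 * (dist x y)\<^sup>2" using st by (intro mult_right_mono mult_le_one) auto
  finally have "(dist ?p ?q)\<^sup>2 \<le> (dist x y)\<^sup>2" by simp
  then show ?thesis unfolding s_def t_def A_def B_def by (rule power2_le_imp_le) simp
qed

lemma chord_same_fraction:
  fixes o' x y :: 'a
  assumes "0 \<le> s" "s \<le> 1"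
  shows "dist (gpt o' x s) (gpt o' y s) \<le> s * dist x y"
proof -
  let ?p = "gpt o' x s" and ?q = "gpt o' y s"
  have 1: "(dist ?p ?q)\<^sup>2 \<le> (1 - s) * (dist ?p o')\<^sup>2 + s * (dist ?p y)\<^sup>2 - s * (1 - s) * (dist o' y)\<^sup>2"
    using assms by (intro stewart_gpt) auto
  have 2: "(dist y ?p)\<^sup>2 \<le> (1 - s) * (dist y o')\<^sup>2 + s * (dist y x)\<^sup>2 - s * (1 - s) * (dist o' x)\<^sup>2"
    using assms by (intro stewart_gpt) auto
  have 3: "dist ?p o' = s * dist o' x" using dist_gpt_left[of s o' x] assms by (simp add: dist_commute)
  have "(dist ?p ?q)\<^sup>2 \<le> (s * dist x y)\<^sup>2"
    using 1 mult_left_mono[OF 2 assms(1)] unfolding 3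
    by (simp add: dist_commute power2_eq_square algebra_simps)
  then show ?thesis by (rule power2_le_imp_le) (use assms in simp)
qed

end

lemma continuous_on_nonexpansive:
  fixes f :: "'b::metric_space \<Rightarrow> real"
  assumes "\<And>x y. \<bar>f x - f y\<bar> \<le> dist x y"
  shows "continuous_on S f"
proof (rule continuous_onI)
  fix x e assume e: "(0::real) < e"
  have "dist (f x') (f x) \<le> e" if "dist x' x < e" for x'
    using assms[of x' x] that by (simp add: dist_real_def)
  then show "\<exists>d>0. \<forall>x'\<in>S. dist x' x < d \<longrightarrow> dist (f x') (f x) \<le> e" using e by blast
qed

section \<open>Projection to a geodesic\<close>

locale cat0_geodesic = cat0 X for X :: "'a::metric_space itself" +
  fixes a :: "real \<Rightarrow> 'a" and I :: "real set"
  assumes geodesic: "geodesic_on I a" and interval: "is_interval I"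
    and closed: "closed I" and nonempty: "I \<noteq> {}"
begin

abbreviation \<phi> :: "'a \<Rightarrow> real" where "\<phi> \<equiv> gpar a I"

definition \<eta> :: "'a \<Rightarrow> real" where "\<eta> x = dist x (a (\<phi> x))"

lemma dist_a: "s \<in> I \<Longrightarrow> t \<in> I \<Longrightarrow> dist (a s) (a t) = \<bar>s - t\<bar>"
  using geodesic by (simp add: geodesic_on_def)

lemma interval_sub: "s \<in> I \<Longrightarrow> t \<in> I \<Longrightarrow> {s..t} \<subseteq> I"
  using interval unfolding is_interval_1 by (meson atLeastAtMost_iff subsetI)

lemma mseg_sub: "s \<in> I \<Longrightarrow> t \<in> I \<Longrightarrow> mseg (a s) (a t) \<subseteq> a ` I"
proof -
  have *: "mseg (a s) (a t) \<subseteq> a ` I" if "s \<in> I" "t \<in> I" "s \<le> t" for s t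
    using mseg_geodesic[OF geodesic interval_sub[OF that(1,2)] that(3)] interval_sub[OF that(1,2)] by auto
  show "s \<in> I \<Longrightarrow> t \<in> I \<Longrightarrow> mseg (a s) (a t) \<subseteq> a ` I"
    using *[of s t] *[of t s] mseg_commute[of "a s" "a t"] by (cases "s \<le> t") auto
qed

lemma continuous_on_a: "continuous_on I a"
proof (rule continuous_onI)
  fix s e :: real assume "s \<in> I" "0 < e"
  then show "\<exists>d>0. \<forall>t\<in>I. dist t s < d \<longrightarrow> dist (a t) (a s) \<le> e"
    by (intro exI[of _ e]) (auto simp: dist_a dist_real_def)
qed

lemma ex_minimizer: "\<exists>\<tau>\<in>I. \<forall>\<sigma>\<in>I. dist x (a \<tau>) \<le> dist x (a \<sigma>)"
proof -
  obtain t where t: "t \<in> I" using nonempty by auto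
  \<comment> \<open>Parameters farther than \<open>M\<close> from \<open>t\<close> give points
    farther from \<open>x\<close> than \<open>a t\<close>, so a minimum over the compact set
    \<open>J\<close> is global.\<close>
  define M where "M = 2 * dist x (a t)"
  define J where "J = I \<inter> {t - M..t + M}"
  have J: "compact J" "t \<in> J" "J \<subseteq> I"
    using closed t by (auto simp: J_def M_def closed_Int_compact)
  then have "continuous_on J (\<lambda>\<sigma>. dist x (a \<sigma>))"
    by (intro continuous_intros continuous_on_subset[OF continuous_on_a]) auto
  then obtain s where s: "s \<in> J" "\<And>\<sigma>. \<sigma> \<in> J \<Longrightarrow> dist x (a s) \<le> dist x (a \<sigma>)"
    using continuous_attains_inf[of J] J by blast
  show ?thesis
  proof (intro bexI ballI)
    show "s \<in> I" using s J by auto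
    fix \<sigma> assume \<sigma>: "\<sigma> \<in> I"
    show "dist x (a s) \<le> dist x (a \<sigma>)"
    proof (cases "\<sigma> \<in> J")
      case False
      then have "M < \<bar>\<sigma> - t\<bar>" using \<sigma> by (auto simp: J_def)
      also have "\<bar>\<sigma> - t\<bar> = dist (a \<sigma>) (a t)" using \<sigma> t by (simp add: dist_a)
      also have "\<dots> \<le> dist x (a \<sigma>) + dist x (a t)" by (metis dist_commute dist_triangle)
      finally show ?thesis using s(2)[OF J(2)] by (simp add: M_def)
    qed (use s in auto)
  qed
qed

lemma minimizer_unique:
  assumes "s \<in> I" "\<And>\<sigma>. \<sigma> \<in> I \<Longrightarrow> dist x (a s) \<le> dist x (a \<sigma>)"
    and "t \<in> I" "\<And>\<sigma>. \<sigma> \<in> I \<Longrightarrow> dist x (a t) \<le> dist x (a \<sigma>)"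
  shows "s = t"
proof -
  have e: "dist x (a s) = dist x (a t)" using assms by (intro antisym) auto
  have "mseg (a s) (a t) \<subseteq> a ` I" using assms by (intro mseg_sub)
  then have "(dist x (a s))\<^sup>2 + (dist (a s) (a t))\<^sup>2 \<le> (dist x (a t))\<^sup>2"
    using assms by (intro proj_ineq) auto
  then show ?thesis using e assms by (simp add: dist_a)
qed

lemma \<phi>_prop: "\<phi> x \<in> I \<and> (\<forall>\<sigma>\<in>I. dist x (a (\<phi> x)) \<le> dist x (a \<sigma>))"
proof -
  have "\<exists>!\<tau>. \<tau> \<in> I \<and> (\<forall>\<sigma>\<in>I. dist x (a \<tau>) \<le> dist x (a \<sigma>))"
    using ex_minimizer[of x] minimizer_unique[of _ x] by blast
  then show ?thesis unfolding gpar_def by (rule theI')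
qed

lemma \<phi>_in [simp]: "\<phi> x \<in> I"
  using \<phi>_prop by blast

lemma \<phi>_min: "\<sigma> \<in> I \<Longrightarrow> dist x (a (\<phi> x)) \<le> dist x (a \<sigma>)"
  using \<phi>_prop by blast

lemma \<phi>_eqI: "s \<in> I \<Longrightarrow> (\<And>\<sigma>. \<sigma> \<in> I \<Longrightarrow> dist x (a s) \<le> dist x (a \<sigma>)) \<Longrightarrow> \<phi> x = s"
  using \<phi>_min by (intro minimizer_unique[of _ x]) auto

lemma \<phi>_a [simp]: "s \<in> I \<Longrightarrow> \<phi> (a s) = s"
  by (rule \<phi>_eqI) auto

lemma closest_proj_eq: "closest_proj (a ` I) x = a (\<phi> x)"
  unfolding closest_proj_def
proof (rule the_equality)
  show "a (\<phi> x) \<in> a ` I \<and> (\<forall>q\<in>a ` I. dist x (a (\<phi> x)) \<le> dist x q)"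
    using \<phi>_min by auto
  fix p assume p: "p \<in> a ` I \<and> (\<forall>q\<in>a ` I. dist x p \<le> dist x q)"
  then obtain s where "s \<in> I" "p = a s" by auto
  then show "p = a (\<phi> x)" using p \<phi>_eqI[of s x] by auto
qed

lemma \<phi>_ineq: "s \<in> I \<Longrightarrow> (dist x (a (\<phi> x)))\<^sup>2 + (s - \<phi> x)\<^sup>2 \<le> (dist x (a s))\<^sup>2"
  using proj_ineq[of "a (\<phi> x)" "a s" x] mseg_sub[of "\<phi> x" s] \<phi>_min
  by (fastforce simp: dist_a power2_commute)

text \<open>The quadrilateral inequality for \<open>x\<close>, \<open>y\<close> and their feet, with
  the right angles at the feet from \<open>\<phi>_ineq\<close>, reduces to
  \<open>P * P \<le> P * dist x y\<close>.\<close>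

lemma \<phi>_lipschitz: "\<bar>\<phi> x - \<phi> y\<bar> \<le> dist x y"
proof -
  define P where "P = \<bar>\<phi> x - \<phi> y\<bar>"
  have P: "P\<^sup>2 = (\<phi> x - \<phi> y)\<^sup>2" "P\<^sup>2 = (\<phi> y - \<phi> x)\<^sup>2" by (auto simp: P_def power2_commute)
  have "(dist x (a (\<phi> y)))\<^sup>2 + (dist y (a (\<phi> x)))\<^sup>2
      \<le> (dist x (a (\<phi> x)))\<^sup>2 + (dist y (a (\<phi> y)))\<^sup>2 + 2 * P * dist x y"
    using quadrilateral[of x "a (\<phi> y)" y "a (\<phi> x)"] by (simp add: dist_a P_def)
  then have "P * P \<le> P * dist x y"
    using \<phi>_ineq[of "\<phi> y" x] \<phi>_ineq[of "\<phi> x" y] P by (simp add: power2_eq_square)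
  moreover have "0 \<le> P" by (simp add: P_def)
  ultimately show ?thesis unfolding P_def[symmetric]
    by (cases "P = 0") (auto simp: mult_le_cancel_left_pos)
qed

lemma continuous_on_\<phi>: "continuous_on S \<phi>"
  by (rule continuous_on_nonexpansive) (rule \<phi>_lipschitz)

lemma \<eta>_nonneg [simp]: "0 \<le> \<eta> x"
  by (simp add: \<eta>_def)

lemma \<eta>_le: "s \<in> I \<Longrightarrow> \<eta> x \<le> dist x (a s)"
  by (simp add: \<eta>_def \<phi>_min)

lemma \<eta>_lipschitz: "\<eta> x \<le> dist x y + \<eta> y"
  using \<eta>_le[of "\<phi> y" x] dist_triangle[of x "a (\<phi> y)" y] by (simp add: \<eta>_def)

lemma \<phi>_mseg: "w \<in> mseg x (a (\<phi> x)) \<Longrightarrow> \<phi> w = \<phi> x"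
proof (rule \<phi>_eqI)
  fix s assume w: "w \<in> mseg x (a (\<phi> x))" "s \<in> I"
  then have "dist x (a (\<phi> x)) \<le> dist x (a s)" by (simp add: \<phi>_min)
  then show "dist w (a (\<phi> x)) \<le> dist w (a s)"
    using w dist_triangle[of x "a s" w] by (simp add: mseg_def)
qed simp

text \<open>Each point is joined to its foot by a segment on which \<open>\<phi>\<close> is
  constant, and the feet are joined along the geodesic. This is the source of connectedness of
  curtains and half spaces, which replaces convexity.\<close>

lemma connected_\<phi>_vimage:
  assumes K: "is_interval K" "K \<subseteq> I"
  shows "connected {x. \<phi> x \<in> K}"
proof (subst connected_iff_connected_component, intro ballI)
  fix x y assume xy: "x \<in> {x. \<phi> x \<in> K}" "y \<in> {x. \<phi> x \<in> K}"
  let ?T = "mseg x (a (\<phi> x)) \<union> a ` K \<union> mseg y (a (\<phi> y))"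
  have "connected (a ` K)"
    using K by (intro connected_continuous_image continuous_on_subset[OF continuous_on_a])
      (auto simp: is_interval_connected)
  then have 1: "connected (mseg x (a (\<phi> x)) \<union> a ` K)"
    using xy mseg_ends(2)[of "a (\<phi> x)" x] by (intro connected_Un connected_mseg) blast+
  then have "connected ?T"
    using xy mseg_ends(2)[of "a (\<phi> y)" y] by (intro connected_Un[OF 1] connected_mseg) blast
  moreover have "?T \<subseteq> {x. \<phi> x \<in> K}"
    using xy K by (auto simp: \<phi>_mseg subset_iff)
  ultimately show "connected_component {x. \<phi> x \<in> K} x y"
    unfolding connected_component_def by (intro exI[of _ ?T]) auto
qed

lemma cat0_geodesic_sub:
  assumes "J \<subseteq> I" "is_interval J" "closed J" "J \<noteq> {}"
  shows "cat0_geodesic a J"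
  by unfold_locales (use assms geodesic in \<open>auto simp: geodesic_on_def\<close>)

text \<open>By convexity the distance from \<open>x\<close> does not decrease along the geodesic
  away from \<open>\<phi> x\<close> (\<open>between\<close>), so over a subinterval it is minimal at
  the clamped parameter.\<close>

lemma gpar_restrict:
  assumes r: "r1 \<le> r2" "r1 \<in> I" "r2 \<in> I"
  shows "gpar a {r1..r2} x = max r1 (min r2 (\<phi> x))"
proof -
  interpret J: cat0_geodesic X a "{r1..r2}"
    by (rule cat0_geodesic_sub) (use r interval_sub in auto)
  have between: "dist x (a s) \<le> dist x (a t)"
    if "s \<in> I" "t \<in> I" "\<phi> x \<le> s \<and> s \<le> t \<or> t \<le> s \<and> s \<le> \<phi> x" for s t
  proof (cases "t = \<phi> x")
    case True
    then show ?thesis using that by auto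
  next
    case False
    define r where "r = (s - t) / (\<phi> x - t)"
    have r: "0 \<le> r" "r \<le> 1" "t + r * (\<phi> x - t) = s"
      using that False by (auto simp: r_def divide_simps)
    then have "gpt (a t) (a (\<phi> x)) r = a s"
      using that geodesic_gpt[OF geodesic, of t "\<phi> x" r] by simp
    then have "(dist x (a s))\<^sup>2 \<le> (1 - r) * (dist x (a t))\<^sup>2 + r * (dist x (a (\<phi> x)))\<^sup>2
        - r * (1 - r) * (dist (a t) (a (\<phi> x)))\<^sup>2"
      using stewart_gpt[of r x "a t" "a (\<phi> x)"] r by simp
    also have "\<dots> \<le> (1 - r) * (dist x (a t))\<^sup>2 + r * (dist x (a t))\<^sup>2 - 0"
      using r that \<phi>_min[of t x] by (intro diff_mono add_mono mult_left_mono power_mono) auto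
    finally show ?thesis by (simp add: algebra_simps)
  qed
  show ?thesis
  proof (rule J.\<phi>_eqI)
    fix \<sigma> assume \<sigma>: "\<sigma> \<in> {r1..r2}"
    then have "\<sigma> \<in> I" using interval_sub[OF r(2,3)] by auto
    then show "dist x (a (max r1 (min r2 (\<phi> x)))) \<le> dist x (a \<sigma>)"
      using between[of r1 \<sigma>] between[of r2 \<sigma>] \<phi>_min[of \<sigma> x] \<sigma> r by (auto simp: max_def min_def)
  qed (use r in auto)
qed

end

section \<open>Curtains and chains\<close>

text \<open>The function \<open>g\<close> is the signed distance, measured along the dual geodesic, from the
  centre of the curtain. The two half spaces are where \<open>g < -1/2\<close> and \<open>g > 1/2\<close>.\<close>

definition curtain_fun :: "'a::metric_space set \<Rightarrow> ('a \<Rightarrow> real) \<Rightarrow> bool" where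
  "curtain_fun h g \<longleftrightarrow> (\<forall>x y. \<bar>g x - g y\<bar> \<le> dist x y) \<and> h = {x. \<bar>g x\<bar> \<le> 1/2} \<and> h \<noteq> {} \<and>
     connected h \<and> connected {x. g x \<le> 1/2} \<and> connected {x. g x \<ge> - 1/2}"

lemma curtain_fun_uminus: "curtain_fun h g \<Longrightarrow> curtain_fun h (\<lambda>x. - g x)"
proof -
  assume h: "curtain_fun h g"
  have "\<bar>- g x + g y\<bar> \<le> dist x y" for x y
    using h unfolding curtain_fun_def by (metis abs_minus_commute uminus_add_conv_diff)
  moreover have "{x. - g x \<le> 1/2} = {x. g x \<ge> - 1/2}" "{x. - g x \<ge> - 1/2} = {x. g x \<le> 1/2}" by auto
  ultimately show ?thesis using h unfolding curtain_fun_def abs_minus_cancel by auto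
qed

lemma curtain_fun_lipschitz: "curtain_fun h g \<Longrightarrow> \<bar>g x - g y\<bar> \<le> dist x y"
  by (simp add: curtain_fun_def)

lemma curtain_fun_in: "curtain_fun h g \<Longrightarrow> x \<in> h \<longleftrightarrow> \<bar>g x\<bar> \<le> 1/2"
  by (auto simp: curtain_fun_def)

lemma curtain_fun_continuous: "curtain_fun h g \<Longrightarrow> continuous_on S g"
  by (rule continuous_on_nonexpansive) (rule curtain_fun_lipschitz)

lemma curtain_fun_side:
  assumes h: "curtain_fun h g" and T: "connected T" "T \<inter> h = {}" "x \<in> T" "g x < - 1/2"
  shows "T \<subseteq> {y. g y < - 1/2}"
proof (rule ccontr)
  assume "\<not> ?thesis"
  then obtain y where y: "y \<in> T" "g y \<ge> - 1/2" by force
  have "connected (g ` T)" by (intro connected_continuous_image curtain_fun_continuous[OF h] T)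
  then have "- 1/2 \<in> g ` T" using connectedD_interval[of "g ` T" "g x" "g y" "- 1/2"] y T by auto
  then show False using T(2) curtain_fun_in[OF h] by auto
qed

lemma curtain_fun_side':
  assumes h: "curtain_fun h g" and T: "connected T" "T \<inter> h = {}" "x \<in> T" "g x > 1/2"
  shows "T \<subseteq> {y. g y > 1/2}"
  using curtain_fun_side[OF curtain_fun_uminus[OF h] T(1-3)] T(4) by auto

text \<open>The lower half space of \<open>h\<close> is connected and misses \<open>h'\<close>; the
  single point \<open>x\<close> decides on which side of \<open>h'\<close> it lies.\<close>

lemma curtain_fun_lower_disjoint:
  assumes "curtain_fun h g" "curtain_fun h' g'" "h \<inter> h' = {}" "h' \<subseteq> {x. g x > 1/2}"
    and "x \<in> {x. g x \<le> 1/2}" "g' x < - 1/2"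
  shows "{x. g x \<le> 1/2} \<subseteq> {x. g' x < - 1/2}"
  using assms by (intro curtain_fun_side[of h' g' _ x]) (auto simp: curtain_fun_def)

lemma curtain_separates_sym: "curtain_separates h A B \<longleftrightarrow> curtain_separates h B A"
  unfolding curtain_separates_def by blast

context cat0
begin

definition dual_curtain :: "(real \<Rightarrow> 'a) \<Rightarrow> real set \<Rightarrow> real \<Rightarrow> 'a set" where
  "dual_curtain a I r = {x. gpar a I x \<in> {r - 1/2..r + 1/2}}"

lemma in_dual_curtain: "x \<in> dual_curtain a I r \<longleftrightarrow> \<bar>gpar a I x - r\<bar> \<le> 1/2"
  unfolding dual_curtain_def mem_Collect_eq atLeastAtMost_iff by linarith

lemma curtain_halves_eq:
  assumes "cat0_geodesic a I"
    and r: "{r - 1/2..r + 1/2} \<subseteq> interior I"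
  shows "closest_proj (a ` I) -` a ` {r - 1/2..r + 1/2} = dual_curtain a I r"
    and "closest_proj (a ` I) -` a ` (I \<inter> {..<r - 1/2}) = {x. gpar a I x < r - 1/2}"
    and "closest_proj (a ` I) -` a ` (I \<inter> {r + 1/2<..}) = {x. gpar a I x > r + 1/2}"
proof -
  interpret cat0_geodesic X a I by fact
  have inj: "a s = a t \<Longrightarrow> s \<in> I \<Longrightarrow> t \<in> I \<Longrightarrow> s = t" for s t
    using dist_a[of s t] by simp
  have J: "a (\<phi> x) \<in> a ` J \<longleftrightarrow> \<phi> x \<in> J" if "J \<subseteq> I" for J x
  proof
    assume "a (\<phi> x) \<in> a ` J"
    then obtain s where "s \<in> J" "a (\<phi> x) = a s" by auto
    then show "\<phi> x \<in> J" using inj[of "\<phi> x" s] that by auto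
  qed auto
  have "{r - 1/2..r + 1/2} \<subseteq> I" using r interior_subset by blast
  note * = vimage_def closest_proj_eq J[OF this] J[of "I \<inter> {..<r - 1/2}", OF Int_lower1]
    J[of "I \<inter> {r + 1/2<..}", OF Int_lower1]
  show "closest_proj (a ` I) -` a ` {r - 1/2..r + 1/2} = dual_curtain a I r"
    and "closest_proj (a ` I) -` a ` (I \<inter> {..<r - 1/2}) = {x. gpar a I x < r - 1/2}"
    and "closest_proj (a ` I) -` a ` (I \<inter> {r + 1/2<..}) = {x. gpar a I x > r + 1/2}"
    unfolding * by (simp_all add: dual_curtain_def)
qed

lemma dual_curtain_halves:
  assumes "cat0_geodesic a I" "{r - 1/2..r + 1/2} \<subseteq> interior I"
  shows "curtain_halves (dual_curtain a I r) {x. gpar a I x < r - 1/2} {x. gpar a I x > r + 1/2}"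
proof -
  interpret cat0_geodesic X a I by fact
  show ?thesis unfolding curtain_halves_def
    by (intro exI[of _ I] exI[of _ a] exI[of _ r])
      (simp add: curtain_halves_eq[OF assms] assms(2) interval closed geodesic)
qed

lemma curtain_halvesE:
  fixes h :: "'a set"
  assumes "curtain_halves h hm hp"
  obtains a I r where "cat0_geodesic a I" "{r - 1/2..r + 1/2} \<subseteq> interior I"
    "h = dual_curtain a I r" "hm = {x. gpar a I x < r - 1/2}" "hp = {x. gpar a I x > r + 1/2}"
proof -
  from assms obtain I a r where *: "is_interval I" "closed I" "geodesic_on I a"
        "{r - 1/2..r + 1/2} \<subseteq> interior I"
        "h = closest_proj (a ` I) -` a ` {r - 1/2..r + 1/2}"
        "hm = closest_proj (a ` I) -` a ` (I \<inter> {..<r - 1/2})"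
        "hp = closest_proj (a ` I) -` a ` (I \<inter> {r + 1/2<..})"
    unfolding curtain_halves_def by blast
  have "I \<noteq> {}" using *(4) interior_subset[of I] by auto
  then have c: "cat0_geodesic a I" using * by unfold_locales auto
  show thesis by (rule that[OF c *(4)]) (use *(5-7) curtain_halves_eq[OF c *(4)] in simp_all)
qed

lemma curtain_fun_dual:
  assumes "cat0_geodesic a I" "{r - 1/2..r + 1/2} \<subseteq> interior I"
  shows "curtain_fun (dual_curtain a I r) (\<lambda>x. gpar a I x - r)"
proof -
  interpret cat0_geodesic X a I by fact
  have sub: "{r - 1/2..r + 1/2} \<subseteq> I" using assms interior_subset by blast
  have r: "r \<in> I" using sub by auto
  have "dual_curtain a I r = {x. \<phi> x \<in> {r - 1/2..r + 1/2}}"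
    by (simp add: dual_curtain_def)
  moreover have "connected {x. \<phi> x \<in> {r - 1/2..r + 1/2}}"
    using sub by (intro connected_\<phi>_vimage) auto
  moreover have "{x. \<phi> x - r \<le> 1/2} = {x. \<phi> x \<in> I \<inter> {..r + 1/2}}"
      "{x. \<phi> x - r \<ge> - 1/2} = {x. \<phi> x \<in> I \<inter> {r - 1/2..}}"
    by auto
  moreover have "connected {x. \<phi> x \<in> I \<inter> {..r + 1/2}}" "connected {x. \<phi> x \<in> I \<inter> {r - 1/2..}}"
    by (intro connected_\<phi>_vimage is_interval_Int interval is_interval_ic is_interval_ci Int_lower1)+
  moreover have "a r \<in> dual_curtain a I r" using r by (simp add: dual_curtain_def)
  ultimately show ?thesis unfolding curtain_fun_def
    using \<phi>_lipschitz by (auto simp: in_dual_curtain)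
qed

lemma curtain_separatesE:
  fixes h :: "'a set"
  assumes "curtain_separates h A B"
  obtains g where "curtain_fun h g" "A \<subseteq> {x. g x < - 1/2}" "B \<subseteq> {x. g x > 1/2}"
proof -
  obtain hm hp where h: "curtain_halves h hm hp" "A \<subseteq> hm \<and> B \<subseteq> hp \<or> B \<subseteq> hm \<and> A \<subseteq> hp"
    using assms unfolding curtain_separates_def by blast
  obtain a I r where *: "cat0_geodesic a I" "{r - 1/2..r + 1/2} \<subseteq> interior I"
    "h = dual_curtain a I r" "hm = {x. gpar a I x < r - 1/2}" "hp = {x. gpar a I x > r + 1/2}"
    using h(1) by (rule curtain_halvesE)
  note g = curtain_fun_dual[OF *(1,2), folded *(3)]
  from h(2) show thesis
  proof
    assume "A \<subseteq> hm \<and> B \<subseteq> hp"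
    then show thesis by (intro that[OF g]) (auto simp: *)
  next
    assume "B \<subseteq> hm \<and> A \<subseteq> hp"
    then show thesis by (intro that[OF curtain_fun_uminus[OF g]]) (auto simp: *)
  qed
qed

lemma curtain_has_fun:
  fixes h :: "'a set"
  assumes "curtain h"
  obtains g where "curtain_fun h g"
proof -
  obtain hm hp where "curtain_halves h hm hp" using assms unfolding curtain_def by blast
  then show thesis by (rule curtain_halvesE) (metis curtain_fun_dual that)
qed

text \<open>Each point descends to its foot inside the curtain, since \<open>\<phi>\<close> is
  constant on the way, and both feet lie on a stretch of length 1 of the dual geodesic.\<close>

lemma curtain_path:
  fixes h :: "'a set"
  assumes "curtain h" "x \<in> h" "y \<in> h"
  obtains p q where "mseg x p \<subseteq> h" "mseg q y \<subseteq> h" "dist p q \<le> 1"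
proof -
  obtain a I r where *: "cat0_geodesic a I" "{r - 1/2..r + 1/2} \<subseteq> interior I"
    "h = dual_curtain a I r"
  proof -
    obtain hm hp where "curtain_halves h hm hp" using assms unfolding curtain_def by blast
    then show thesis by (rule curtain_halvesE) (rule that)
  qed
  interpret cat0_geodesic X a I by fact
  show thesis
  proof (rule that)
    show "mseg x (a (\<phi> x)) \<subseteq> h" using assms(2) * \<phi>_mseg by (auto simp: dual_curtain_def)
    have "mseg y (a (\<phi> y)) \<subseteq> h" using assms(3) * \<phi>_mseg by (auto simp: dual_curtain_def)
    then show "mseg (a (\<phi> y)) y \<subseteq> h" by (simp add: mseg_commute)
    have "\<bar>\<phi> x - r\<bar> \<le> 1/2" "\<bar>\<phi> y - r\<bar> \<le> 1/2" using assms(2,3) * by (simp_all add: in_dual_curtain)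
    then show "dist (a (\<phi> x)) (a (\<phi> y)) \<le> 1" using dist_a[OF \<phi>_in \<phi>_in, of x y] by linarith
  qed
qed

lemma dual_curtain_chain:
  fixes N :: nat
  assumes "cat0_geodesic a I" "1 < g"
    and r: "\<And>i. i < N \<Longrightarrow> {\<rho> + real i * g - 1/2..\<rho> + real i * g + 1/2} \<subseteq> interior I"
  defines "h \<equiv> \<lambda>i. dual_curtain a I (\<rho> + real i * g)"
  shows "curtain_chain (h ` {..<N})" and "inj_on h {..<N}"
    and "\<And>i j. i < N \<Longrightarrow> j < N \<Longrightarrow> i \<noteq> j \<Longrightarrow> h i \<inter> h j = {}"
proof -
  interpret cat0_geodesic X a I by fact
  have step: "g \<le> real j * g - real i * g" if "i < j" for i j :: nat
  proof -
    have "1 * g \<le> (real j - real i) * g" using that assms(2) by (intro mult_right_mono) auto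
    then show ?thesis by (simp add: algebra_simps)
  qed
  have less: "x \<notin> h j" if "i < j" "x \<in> h i" for i j x
    using step[OF that(1)] that(2) assms(2) by (auto simp: h_def dual_curtain_def abs_le_iff)
  then show disj: "h i \<inter> h j = {}" if "i < N" "j < N" "i \<noteq> j" for i j
    using that by (metis disjoint_iff linorder_neqE_nat)
  have ne: "h i \<noteq> {}" if "i < N" for i
    using curtain_fun_dual[OF assms(1) r[OF that]] unfolding h_def curtain_fun_def by blast
  show "inj_on h {..<N}"
  proof (rule inj_onI, rule ccontr)
    fix i j assume "i \<in> {..<N}" "j \<in> {..<N}" "h i = h j" "i \<noteq> j"
    then show False using disj[of i j] ne[of i] by auto
  qed
  have sep: "curtain_separates (h i) (h (i - 1)) (h (i + 1))" if "1 \<le> i" "i + 1 < N" for i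
    unfolding curtain_separates_def
  proof (intro exI conjI disjI1)
    show "curtain_halves (h i) {x. \<phi> x < \<rho> + real i * g - 1/2} {x. \<phi> x > \<rho> + real i * g + 1/2}"
      unfolding h_def using that by (intro dual_curtain_halves[OF assms(1)] r) auto
    show "h (i - 1) \<subseteq> {x. \<phi> x < \<rho> + real i * g - 1/2}"
      using step[of "i - 1" i] that assms(2) by (auto simp: h_def dual_curtain_def abs_le_iff)
    show "h (i + 1) \<subseteq> {x. \<phi> x > \<rho> + real i * g + 1/2}"
      using step[of i "i + 1"] that assms(2) by (auto simp: h_def dual_curtain_def abs_le_iff)
  qed
  show "curtain_chain (h ` {..<N})"
    unfolding curtain_chain_def
  proof (intro exI[of _ "int ` {..<N}"] exI[of _ "\<lambda>i. h (nat i)"] conjI ballI allI impI)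
    have J: "int ` {..<N} = {0..<int N}"
      by (simp add: image_int_atLeastLessThan lessThan_atLeast0)
    fix i j assume "i \<in> int ` {..<N}" "j \<in> int ` {..<N}"
    then show "{i..j} \<subseteq> int ` {..<N}" unfolding J by auto
  next
    show "h ` {..<N} = (\<lambda>i. h (nat i)) ` int ` {..<N}" by (simp add: image_image)
    show "disjoint_family_on (\<lambda>i. h (nat i)) (int ` {..<N})"
      using disj by (auto simp: disjoint_family_on_def)
  next
    fix i assume "i \<in> int ` {..<N}"
    then show "curtain (h (nat i))"
      unfolding h_def curtain_def using dual_curtain_halves[OF assms(1) r] by fastforce
  next
    fix i assume i: "i - 1 \<in> int ` {..<N} \<and> i \<in> int ` {..<N} \<and> i + 1 \<in> int ` {..<N}"
    then have "1 \<le> nat i" "nat i + 1 < N" by auto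
    moreover have "nat (i - 1) = nat i - 1" "nat (i + 1) = nat i + 1" using i by auto
    ultimately show "curtain_separates (h (nat i)) (h (nat (i - 1))) (h (nat (i + 1)))"
      using sep[of "nat i"] by simp
  qed
qed

end

section \<open>Counting curtains that separate two points or meet a bounded set\<close>

lemma card_disjoint_unit_intervals:
  fixes f g :: "'b \<Rightarrow> real"
  assumes "finite c" "disjoint_family_on (\<lambda>h. {f h..g h}) c"
    and "\<And>h. h \<in> c \<Longrightarrow> 0 \<le> f h \<and> f h + 1 \<le> g h \<and> g h \<le> l" and "0 \<le> l"
  shows "real (card c) \<le> l"
proof -
  have "real (card c) = (\<Sum>h\<in>c. 1)" by simp
  also have "\<dots> \<le> (\<Sum>h\<in>c. measure lborel {f h..g h})"
  proof (intro sum_mono)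
    fix h assume "h \<in> c"
    then have "0 \<le> f h \<and> f h + 1 \<le> g h" using assms(3) by blast
    then show "1 \<le> measure lborel {f h..g h}" by simp
  qed
  also have "\<dots> = measure lborel (\<Union>h\<in>c. {f h..g h})"
    using assms(1,2) by (intro measure_finite_Union[symmetric]) (auto simp: emeasure_lborel_Icc_eq)
  also have "\<dots> \<le> measure lborel {0..l}"
  proof (rule measure_mono_fmeasurable)
    show "(\<Union>h\<in>c. {f h..g h}) \<subseteq> {0..l}" using assms(3) by fastforce
    show "(\<Union>h\<in>c. {f h..g h}) \<in> sets lborel" using assms(1) by (intro sets.finite_UN) auto
    show "{0..l} \<in> fmeasurable lborel" by (intro fmeasurableI) (auto simp: emeasure_lborel_Icc_eq)
  qed
  also have "\<dots> = l" using assms by simp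
  finally show ?thesis .
qed

lemma last_time_le:
  fixes f :: "real \<Rightarrow> real"
  assumes "continuous_on {a..b} f" "a \<le> b" "f a \<le> v" "v \<le> f b"
  shows "\<exists>s. a \<le> s \<and> s \<le> b \<and> f s = v \<and> (\<forall>t\<in>{s..b}. v \<le> f t)"
proof -
  define S where "S = {a..b} \<inter> f -` {..v}"
  have c: "closed S" unfolding S_def by (intro continuous_closed_preimage assms) auto
  have "a \<in> S" using assms by (simp add: S_def)
  then have ne: "S \<noteq> {}" by blast
  have b: "bdd_above S" unfolding S_def by (rule bdd_aboveI[of _ b]) simp
  have s: "Sup S \<in> S" using closed_contains_Sup[OF ne b c] .
  then have s': "a \<le> Sup S" "Sup S \<le> b" "f (Sup S) \<le> v" by (simp_all add: S_def)
  have gt: "v < f t" if "Sup S < t" "t \<le> b" for t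
  proof (rule ccontr)
    assume "\<not> v < f t"
    then have "t \<in> S" using that s' by (simp add: S_def)
    then have "t \<le> Sup S" using b by (rule cSup_upper)
    then show False using that by simp
  qed
  have "f (Sup S) = v"
  proof (rule ccontr)
    assume "f (Sup S) \<noteq> v"
    then have lt: "f (Sup S) < v" using s' by simp
    have "continuous_on {Sup S..b} f" using s' by (intro continuous_on_subset[OF assms(1)]) simp
    then obtain t where t: "Sup S \<le> t" "t \<le> b" "f t = v"
      using IVT'[of f "Sup S" v b] lt s' assms(4) by fastforce
    then show False using lt gt[of t] by (cases "t = Sup S") auto
  qed
  moreover have "v \<le> f t" if "t \<in> {Sup S..b}" for t
    using that gt[of t] \<open>f (Sup S) = v\<close> by (cases "t = Sup S") auto
  ultimately show ?thesis using s' by blast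
qed

lemma first_time_ge:
  fixes f :: "real \<Rightarrow> real"
  assumes "continuous_on {a..b} f" "a \<le> b" "f a \<le> v" "v \<le> f b"
  shows "\<exists>s. a \<le> s \<and> s \<le> b \<and> f s = v \<and> (\<forall>t\<in>{a..s}. f t \<le> v)"
proof -
  have "continuous_on {-b..-a} (\<lambda>t. - f (- t))"
    by (intro continuous_intros continuous_on_compose2[OF assms(1)]) auto
  from last_time_le[OF this, of "- v"] assms obtain s where
    s: "- b \<le> s" "s \<le> - a" "f (- s) = v" "\<forall>t\<in>{s..- a}. - v \<le> - f (- t)"
    by auto
  have "f t \<le> v" if "t \<in> {a..- s}" for t
    using s(4) that by (auto dest: bspec[of _ _ "- t"])
  then show ?thesis using s by (intro exI[of _ "- s"]) auto
qed

lemma finite_int_set_card_bound: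
  fixes J :: "int set"
  assumes "\<And>i j. i \<in> J \<Longrightarrow> j \<in> J \<Longrightarrow> i < j \<Longrightarrow> j - i \<le> int M"
  shows "finite J \<and> card J \<le> M + 1"
proof (cases "J = {}")
  case False
  then obtain k where k: "k \<in> J" by auto
  have "J \<subseteq> {k - int M..k + int M}"
  proof
    fix i assume "i \<in> J"
    then show "i \<in> {k - int M..k + int M}"
      using assms[of i k] assms[of k i] k by (cases i k rule: linorder_cases) auto
  qed
  then have fin: "finite J" by (rule finite_subset) simp
  have "J \<subseteq> {Min J..Min J + int M}"
  proof
    fix i assume "i \<in> J"
    then show "i \<in> {Min J..Min J + int M}"
      using assms[of "Min J" i] Min_le[OF fin, of i] Min_in[OF fin] False
      by (cases "Min J = i") auto
  qed
  then have "card J \<le> card {Min J..Min J + int M}" by (intro card_mono) auto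
  then show ?thesis using fin by simp
qed simp

text \<open>A chain is only required to separate neighbours; connected half spaces nest along the
  index. The induction for the left side comes first, because the one for the right side uses that
  \<open>h m\<close> lies below every later curtain.\<close>

lemma chain_separates_all:
  fixes h :: "int \<Rightarrow> 'a::metric_space set"
  assumes J: "\<And>i j. i \<in> J \<Longrightarrow> j \<in> J \<Longrightarrow> {i..j} \<subseteq> J"
    and g: "\<And>i. i - 1 \<in> J \<Longrightarrow> i + 1 \<in> J \<Longrightarrow> curtain_fun (h i) (g i) \<and>
        h (i - 1) \<subseteq> {x. g i x < - 1/2} \<and> h (i + 1) \<subseteq> {x. g i x > 1/2}"
    and con: "\<And>i. i \<in> J \<Longrightarrow> connected (h i) \<and> h i \<noteq> {}"
    and disj: "disjoint_family_on h J"
    and ij: "i \<in> J" "j \<in> J" "i < m" "m < j"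
  shows "h i \<subseteq> {x. g m x < - 1/2} \<and> h j \<subseteq> {x. g m x > 1/2}"
proof -
  have in_J: "k \<in> J" if "k1 \<in> J" "k2 \<in> J" "k1 \<le> k" "k \<le> k2" for k k1 k2
    using J[OF that(1,2)] that(3,4) by auto
  have left: "h i \<subseteq> {x. g m x < - 1/2}" if "i \<in> J" "i < m" "m + 1 \<in> J" for i m
    using that(2,3)
  proof (induction m rule: int_gr_induct)
    case base
    then show ?case using g[of "i + 1"] that(1) by auto
  next
    case (step m)
    have m: "m - 1 \<in> J" "m \<in> J" "m + 1 \<in> J" using in_J[of i "m + 1 + 1"] step that(1) by auto
    note gm = g[OF m(1,3)]
    have gm': "curtain_fun (h (m + 1)) (g (m + 1))" "h m \<subseteq> {x. g (m + 1) x < - 1/2}"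
      using g[of "m + 1"] m step.prems by auto
    obtain x where x: "x \<in> h m" using con m by blast
    have "{x. g m x \<le> 1/2} \<subseteq> {x. g (m + 1) x < - 1/2}"
    proof (rule curtain_fun_lower_disjoint[of "h m" _ "h (m + 1)"])
      show "h m \<inter> h (m + 1) = {}" using disj m by (auto simp: disjoint_family_on_def)
      show "x \<in> {x. g m x \<le> 1/2}" using x gm curtain_fun_in[of "h m" "g m" x] by auto
    qed (use gm gm' x in auto)
    then show ?case using step.IH m by force
  qed
  have "m - 1 \<in> J" "m + 1 \<in> J" using in_J[of i j] ij by auto
  note gm = g[OF this]
  have mJ: "m \<in> J" using in_J[of i j] ij by auto
  have "h j \<subseteq> {x. g m x > 1/2}"
    using ij(4,2)
  proof (induction j rule: int_gr_induct)
    case base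
    then show ?case using gm by auto
  next
    case (step k)
    have kJ: "k - 1 \<in> J" "k \<in> J" using in_J[of m "k + 1"] step mJ by auto
    have gk: "curtain_fun (h k) (g k)" "h (k + 1) \<subseteq> {x. g k x > 1/2}"
      using g[of k] kJ step.prems by auto
    have mk: "h m \<subseteq> {x. g k x < - 1/2}" using left[of m k] mJ step by auto
    obtain x where x: "x \<in> h k" using con kJ by blast
    have sub: "{x. g k x \<ge> - 1/2} \<subseteq> {x. g m x > 1/2}"
    proof (rule curtain_fun_side'[of "h m"])
      show "curtain_fun (h m) (g m)" using gm by simp
      show "connected {x. g k x \<ge> - 1/2}" using gk by (simp add: curtain_fun_def)
      show "{x. g k x \<ge> - 1/2} \<inter> h m = {}" using mk by auto
      show "x \<in> {x. g k x \<ge> - 1/2}" using x gk curtain_fun_in[of "h k" "g k" x] by auto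
      show "g m x > 1/2" using step.IH kJ x by auto
    qed
    show ?case
    proof
      fix x assume "x \<in> h (k + 1)"
      then have "g k x > 1/2" using gk by blast
      then show "x \<in> {x. g m x > 1/2}" using sub by force
    qed
  qed
  moreover have "h i \<subseteq> {x. g m x < - 1/2}" using left[of i m] ij \<open>m + 1 \<in> J\<close> by auto
  ultimately show ?thesis by simp
qed

lemma finite_maximal_image:
  fixes M :: "'b \<Rightarrow> 'c set"
  assumes "finite c" "c \<noteq> {}"
  obtains h where "h \<in> c" "\<And>k. k \<in> c \<Longrightarrow> \<not> M h \<subset> M k"
proof -
  obtain m where m: "m \<in> M ` c" "\<forall>b\<in>M ` c. m \<le> b \<longrightarrow> m = b"
    using finite_has_maximal[of "M ` c"] assms by blast
  then obtain h where h: "h \<in> c" "m = M h" by blast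
  show thesis
  proof (rule that[OF h(1)])
    fix k assume "k \<in> c"
    then show "\<not> M h \<subset> M k" using m(2) h(2) by blast
  qed
qed

context cat0
begin

lemma continuous_on_curtain_fun_gpt:
  fixes x y :: 'a
  assumes "curtain_fun h g" "0 \<le> s" "t \<le> 1"
  shows "continuous_on {s..t} (\<lambda>r. g (gpt x y r))"
proof (rule continuous_on_compose2[of UNIV g "{s..t}" "gpt x y"])
  show "continuous_on {s..t} (gpt x y)"
    using assms by (intro continuous_on_subset[OF continuous_on_gpt]) auto
qed (use curtain_fun_continuous[OF assms(1)] in auto)

lemma card_separating_le_dist:
  fixes x y :: 'a
  assumes fin: "finite c" and disj: "\<And>h k. h \<in> c \<Longrightarrow> k \<in> c \<Longrightarrow> h \<noteq> k \<Longrightarrow> h \<inter> k = {}"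
    and g: "\<And>h. h \<in> c \<Longrightarrow> curtain_fun h (g h) \<and> g h x < - 1/2 \<and> g h y > 1/2"
  shows "real (card c) \<le> dist x y"
proof -
  define l where "l = dist x y"
  have ex: "\<exists>s t. 0 \<le> s \<and> s + 1 \<le> t \<and> t \<le> l \<and> (\<forall>r\<in>{s..t}. gpt x y (r / l) \<in> h)" if "h \<in> c" for h
  proof -
    note gh = g[OF that]
    let ?f = "\<lambda>r. g h (gpt x y r)"
    have "0 < dist x y" using gh by (cases "x = y") auto
    then have l: "0 < l" by (simp add: l_def)
    have cont: "continuous_on {0..t} ?f" if "t \<le> 1" for t
      using continuous_on_curtain_fun_gpt[of h "g h" 0 t x y] gh that by simp
    \<comment> \<open>The first time at 1/2, and then the last time at -1/2 before it: in between
      the path stays in \<open>h\<close>, whatever other visits it pays to \<open>h\<close>. The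
      Lipschitz bound makes this piece at least 1 long.\<close>
    obtain t where t: "0 \<le> t" "t \<le> 1" "?f t = 1/2" "\<And>r. r \<in> {0..t} \<Longrightarrow> ?f r \<le> 1/2"
      using first_time_ge[OF cont[OF order_refl], of "1/2"] gh by auto
    obtain s where s: "0 \<le> s" "s \<le> t" "?f s = - 1/2" "\<And>r. r \<in> {s..t} \<Longrightarrow> - 1/2 \<le> ?f r"
      using last_time_le[OF cont[OF t(2)], of "- 1/2"] gh t by auto
    have "1 \<le> dist (gpt x y s) (gpt x y t)"
      using curtain_fun_lipschitz[of h "g h" "gpt x y s" "gpt x y t"] gh s t by auto
    also have "\<dots> = (t - s) * l" using s t by (simp add: dist_gpt_gpt l_def)
    finally have 1: "s * l + 1 \<le> t * l" by (simp add: algebra_simps)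
    show ?thesis
    proof (intro exI conjI ballI)
      show "0 \<le> s * l" "t * l \<le> l" "s * l + 1 \<le> t * l" using s t l 1 by auto
      fix r assume "r \<in> {s * l..t * l}"
      then have r: "s \<le> r / l" "r / l \<le> t" using l by (auto simp: field_simps)
      then have "- 1/2 \<le> ?f (r / l)" "?f (r / l) \<le> 1/2" using s(1) by (intro s(4) t(4); simp)+
      then have "\<bar>?f (r / l)\<bar> \<le> 1/2" by linarith
      then show "gpt x y (r / l) \<in> h" using curtain_fun_in[of h "g h"] gh by blast
    qed
  qed
  then have "\<forall>h\<in>c. \<exists>st. 0 \<le> fst st \<and> fst st + 1 \<le> snd st \<and> snd st \<le> l \<and>
      (\<forall>r\<in>{fst st..snd st}. gpt x y (r / l) \<in> h)"
    by fastforce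
  from bchoice[OF this] obtain st where "\<forall>h\<in>c. 0 \<le> fst (st h) \<and> fst (st h) + 1 \<le> snd (st h)
      \<and> snd (st h) \<le> l \<and> (\<forall>r\<in>{fst (st h)..snd (st h)}. gpt x y (r / l) \<in> h)" by blast
  then obtain f u where fu: "\<And>h. h \<in> c \<Longrightarrow> 0 \<le> f h \<and> f h + 1 \<le> u h \<and> u h \<le> l \<and>
      (\<forall>r\<in>{f h..u h}. gpt x y (r / l) \<in> h)"
    by (rule_tac that[of "\<lambda>h. fst (st h)" "\<lambda>h. snd (st h)"]) blast
  have "disjoint_family_on (\<lambda>h. {f h..u h}) c"
    unfolding disjoint_family_on_def
  proof (intro ballI impI)
    fix h k assume hk: "h \<in> c" "k \<in> c" "h \<noteq> k"
    show "{f h..u h} \<inter> {f k..u k} = {}"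
    proof (rule ccontr)
      assume "{f h..u h} \<inter> {f k..u k} \<noteq> {}"
      then obtain r where "r \<in> {f h..u h}" "r \<in> {f k..u k}" by blast
      then have "gpt x y (r / l) \<in> h \<inter> k" using fu hk by blast
      then show False using disj hk by blast
    qed
  qed
  then show ?thesis
    using card_disjoint_unit_intervals[of c f u l] fin fu by (auto simp: l_def)
qed

lemma L_dist_bounds:
  fixes x y :: 'a
  assumes "x \<noteq> y"
  shows "finite {card c | c. L_chain L c \<and> chain_separates c {x} {y}}"
    and "{card c | c. L_chain L c \<and> chain_separates c {x} {y}} \<noteq> {}"
    and "real (L_dist L x y) \<le> 1 + dist x y"
proof -
  let ?S = "{card c | c. L_chain L c \<and> chain_separates c {x} {y}}"
  have bound: "real (card c) \<le> dist x y" if c: "L_chain L c" "chain_separates c {x} {y}" for c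
  \<comment> \<open>For infinite \<open>c\<close> the bound is trivial, as \<open>card c\<close> is
    then 0.\<close>
  proof (cases "finite c")
    case True
    have "\<exists>g. curtain_fun h g \<and> g x < - 1/2 \<and> g y > 1/2" if "h \<in> c" for h
      using c(2) that curtain_separatesE[of h "{x}" "{y}"] unfolding chain_separates_def by blast
    then obtain g where "\<And>h. h \<in> c \<Longrightarrow> curtain_fun h (g h) \<and> g h x < - 1/2 \<and> g h y > 1/2" by metis
    moreover have "h \<inter> k = {}" if "h \<in> c" "k \<in> c" "h \<noteq> k" for h k
      using c(1) that unfolding L_chain_def L_separated_def by blast
    ultimately show ?thesis using True by (intro card_separating_le_dist)
  qed simp
  then have "?S \<subseteq> {..nat \<lfloor>dist x y\<rfloor>}" by (auto simp: le_nat_floor)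
  then show fin: "finite ?S" by (rule finite_subset) simp
  have "curtain_chain ({} :: 'a set set)"
    unfolding curtain_chain_def by (intro exI[of _ "{}"]) (auto simp: disjoint_family_on_def)
  then have "L_chain L ({} :: 'a set set)" by (simp add: L_chain_def)
  then show ne: "?S \<noteq> {}" unfolding chain_separates_def by blast
  have "Max ?S \<in> ?S" using fin ne by (rule Max_in)
  then have "real (Max ?S) \<le> dist x y" using bound by auto
  then show "real (L_dist L x y) \<le> 1 + dist x y" using assms by (simp add: L_dist_def)
qed

lemma L_dist_ge:
  fixes x y :: 'a
  assumes "x \<noteq> y" "L_chain L c" "chain_separates c {x} {y}"
  shows "1 + card c \<le> L_dist L x y"
  using assms Max_ge[OF L_dist_bounds(1)[OF assms(1)], of "card c" L] by (auto simp: L_dist_def)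

lemma L_dist_attained:
  fixes x y :: 'a
  assumes "x \<noteq> y"
  obtains c where "L_chain L c" "chain_separates c {x} {y}" "L_dist L x y = 1 + card c"
  using Max_in[OF L_dist_bounds(1,2)[OF assms], of L] assms by (auto simp: L_dist_def)

lemma L_dist_mono:
  fixes x y :: 'a
  assumes "L \<le> L'"
  shows "L_dist L x y \<le> L_dist L' x y"
proof (cases "x = y")
  case False
  then obtain c where c: "L_chain L c" "chain_separates c {x} {y}" "L_dist L x y = 1 + card c"
    by (rule L_dist_attained)
  have "L_separated L' h h'" if "L_separated L h h'" for h h' :: "'a set"
    using that assms unfolding L_separated_def by (blast intro: le_trans)
  then have "L_chain L' c" using c(1) unfolding L_chain_def by blast
  then show ?thesis using L_dist_ge[OF False _ c(2)] c(3) by simp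
qed (simp add: L_dist_def)

lemma L_dist_bound: "real (L_dist L x (y::'a)) \<le> 1 + dist x y"
  using L_dist_bounds(3)[of x y L] by (cases "x = y") (simp_all add: L_dist_def)

text \<open>Curtains strictly between two members of the chain separate the points chosen on these
  two, so \<open>card_separating_le_dist\<close> limits the spread of the indices. Infinite chains
  are thereby excluded as well.\<close>

lemma chain_indices_bound:
  fixes c :: "'a set set"
  assumes c: "curtain_chain c" and z: "\<And>k. k \<in> c \<Longrightarrow> z k \<in> k"
    and M: "\<And>k k'. k \<in> c \<Longrightarrow> k' \<in> c \<Longrightarrow> dist (z k) (z k') < real M"
  shows "finite c \<and> card c \<le> M + 1"
proof -
  obtain J :: "int set" and h where J: "\<forall>i\<in>J. \<forall>j\<in>J. {i..j} \<subseteq> J" "c = h ` J"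
      "\<forall>i\<in>J. curtain (h i)" "disjoint_family_on h J"
      "\<forall>i. i - 1 \<in> J \<and> i \<in> J \<and> i + 1 \<in> J \<longrightarrow> curtain_separates (h i) (h (i - 1)) (h (i + 1))"
    using c unfolding curtain_chain_def by blast
  have "\<exists>g. curtain_fun (h i) g \<and> h (i - 1) \<subseteq> {x. g x < - 1/2} \<and> h (i + 1) \<subseteq> {x. g x > 1/2}"
    if "i - 1 \<in> J" "i + 1 \<in> J" for i
  proof -
    have "{i - 1..i + 1} \<subseteq> J" using J(1) that by blast
    then have "i \<in> J" by auto
    then have "curtain_separates (h i) (h (i - 1)) (h (i + 1))" using J(5) that by blast
    then obtain g where "curtain_fun (h i) g" "h (i - 1) \<subseteq> {x. g x < - 1/2}" "h (i + 1) \<subseteq> {x. g x > 1/2}"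
      by (rule curtain_separatesE)
    then show ?thesis by blast
  qed
  then have "\<forall>i. \<exists>g. i - 1 \<in> J \<and> i + 1 \<in> J \<longrightarrow> curtain_fun (h i) g \<and>
        h (i - 1) \<subseteq> {x. g x < - 1/2} \<and> h (i + 1) \<subseteq> {x. g x > 1/2}"
    by blast
  from choice[OF this] obtain g where g: "\<And>i. i - 1 \<in> J \<Longrightarrow> i + 1 \<in> J \<Longrightarrow> curtain_fun (h i) (g i) \<and>
        h (i - 1) \<subseteq> {x. g i x < - 1/2} \<and> h (i + 1) \<subseteq> {x. g i x > 1/2}"
    by blast
  have con: "connected (h i) \<and> h i \<noteq> {}" if "i \<in> J" for i
  proof -
    have "curtain (h i)" using J(3) that by blast
    then obtain g where "curtain_fun (h i) g" by (rule curtain_has_fun)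
    then show ?thesis unfolding curtain_fun_def by blast
  qed
  have inj: "inj_on h J"
  proof (rule inj_onI, rule ccontr)
    fix i j assume "i \<in> J" "j \<in> J" "h i = h j" "i \<noteq> j"
    then have "h i \<inter> h j = {}" using J(4) unfolding disjoint_family_on_def by blast
    then show False using con[OF \<open>i \<in> J\<close>] \<open>h i = h j\<close> by simp
  qed
  have "j - i \<le> int M" if ij: "i \<in> J" "j \<in> J" "i < j" for i j
  proof -
    let ?K = "{i<..<j}"
    have "{i..j} \<subseteq> J" using J(1) ij by blast
    then have in_J: "m \<in> J" if "i \<le> m" "m \<le> j" for m using that by auto
    have K: "?K \<subseteq> J" by (auto intro: in_J)
    have injK: "inj_on h ?K" using inj K by (rule inj_on_subset)
    define G where "G k = g (inv_into ?K h k)" for k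
    have "real (card (h ` ?K)) \<le> dist (z (h i)) (z (h j))"
    proof (rule card_separating_le_dist[where g = G])
      fix k assume "k \<in> h ` ?K"
      then obtain m where m: "m \<in> ?K" "k = h m" by auto
      have G: "G k = g m" using m injK by (simp add: G_def)
      have "h i \<subseteq> {x. g m x < - 1/2} \<and> h j \<subseteq> {x. g m x > 1/2}"
      proof (rule chain_separates_all[of J h g, OF _ g con J(4) ij(1,2)])
        show "{i..j} \<subseteq> J" if "i \<in> J" "j \<in> J" for i j using J(1) that by blast
        show "i < m" "m < j" using m by auto
      qed
      moreover have "m - 1 \<in> J" "m + 1 \<in> J" using m by (auto intro!: in_J)
      ultimately show "curtain_fun k (G k) \<and> G k (z (h i)) < - 1/2 \<and> G k (z (h j)) > 1/2"
        unfolding G unfolding m(2) using g[of m] z[of "h i"] z[of "h j"] ij(1,2) unfolding J(2) by blast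
    next
      fix k k' assume "k \<in> h ` ?K" "k' \<in> h ` ?K" "k \<noteq> k'"
      obtain m where m: "m \<in> ?K" "k = h m" using \<open>k \<in> h ` ?K\<close> by (rule imageE) (rule that)
      obtain m' where m': "m' \<in> ?K" "k' = h m'" using \<open>k' \<in> h ` ?K\<close> by (rule imageE) (rule that)
      have "m \<noteq> m'" using m m' \<open>k \<noteq> k'\<close> by blast
      then show "k \<inter> k' = {}"
        unfolding m(2) m'(2) using disjoint_family_onD[OF J(4), of m m'] K m(1) m'(1) by blast
    qed simp
    also have "\<dots> < real M" using ij(1,2) unfolding J(2) by (intro M[unfolded J(2)]) blast+
    finally have "card (h ` ?K) < M" by simp
    \<comment> \<open>Strictly between there are \<open>j - i - 1\<close> indices, whence
      \<open>j - i \<le> M\<close> and at most \<open>M + 1\<close> indices in all.\<close>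
    then have "nat (j - (i + 1)) < M" using card_image[OF injK] by simp
    then show ?thesis by linarith
  qed
  then have "finite J \<and> card J \<le> M + 1" by (rule finite_int_set_card_bound)
  then show ?thesis using J(2) card_image_le[of J h] by auto
qed

section \<open>Separated curtains\<close>

text \<open>\<open>p\<close> is also the point of [p, u] closest to \<open>z\<close>, so the angle
  at \<open>p\<close> is at least a right angle and [u, z] is the longest side.\<close>

lemma dist_shortest_end:
  fixes p q u z :: 'a
  assumes min: "\<And>w. w \<in> mseg p u \<Longrightarrow> dist p q \<le> dist w q" and z: "z \<in> mseg p q"
  shows "dist u p \<le> dist u z"
proof -
  have "(dist z p)\<^sup>2 + (dist p u)\<^sup>2 \<le> (dist z u)\<^sup>2"
  proof (rule proj_ineq)
    fix w assume "w \<in> mseg p u"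
    from min[OF this] show "dist z p \<le> dist z w"
      using z dist_triangle[of w q z] by (simp add: mseg_def dist_commute)
  qed
  then have "(dist p u)\<^sup>2 \<le> (dist z u)\<^sup>2" using zero_le_power2[of "dist z p"] by linarith
  then show ?thesis by (metis dist_commute power2_le_imp_le zero_le_dist)
qed

text \<open>Otherwise the curtains dual to a shortest segment between \<open>[p1, p2]\<close> and \<open>[q1, q2]\<close> would
  form a chain of more than \<open>L\<close> curtains meeting both \<open>h\<close> and \<open>h'\<close>.\<close>

lemma L_separated_bridge:
  fixes h h' :: "'a set"
  assumes sep: "L_separated L h h'" and con: "connected h" "connected h'"
    and in_h: "p1 \<in> h" "q1 \<in> h" and in_h': "p2 \<in> h'" "q2 \<in> h'"
  obtains p q where "p \<in> mseg p1 p2" "q \<in> mseg q1 q2" "dist p q \<le> real L + 1"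
proof -
  have comp: "compact (mseg u v)" for u v :: 'a
    unfolding mseg_eq by (intro compact_continuous_image continuous_on_gpt) simp
  have "compact (mseg p1 p2 \<times> mseg q1 q2)" by (intro compact_Times comp)
  moreover have "mseg p1 p2 \<times> mseg q1 q2 \<noteq> {}" using mseg_ends by blast
  moreover have "continuous_on (mseg p1 p2 \<times> mseg q1 q2) (\<lambda>(p, q). dist p q)"
    unfolding case_prod_unfold by (intro continuous_intros)
  ultimately have "\<exists>pq\<in>mseg p1 p2 \<times> mseg q1 q2. \<forall>w\<in>mseg p1 p2 \<times> mseg q1 q2.
      (\<lambda>(p, q). dist p q) pq \<le> (\<lambda>(p, q). dist p q) w"
    by (rule continuous_attains_inf)
  then obtain p q where p: "p \<in> mseg p1 p2" "q \<in> mseg q1 q2"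
    and min': "\<forall>w\<in>mseg p1 p2 \<times> mseg q1 q2. dist p q \<le> (\<lambda>(p, q). dist p q) w"
    by force
  have min: "dist p q \<le> dist w v" if "w \<in> mseg p1 p2" "v \<in> mseg q1 q2" for w v
    using bspec[OF min', of "(w, v)"] that by simp
  show thesis
  proof (cases "dist p q \<le> real L + 1")
    case True
    then show thesis using that p by blast
  next
    case False
    define \<delta> a where "\<delta> = dist p q" and "a s = gpt p q (s / \<delta>)" for s
    have \<delta>: "real L + 1 < \<delta>" using False by (simp add: \<delta>_def)
    then have "p \<noteq> q" by (auto simp: \<delta>_def)
    then have geo: "geodesic_on {0..\<delta>} a" unfolding a_def \<delta>_def by (rule geodesic_on_gpt)
    interpret A: cat0_geodesic X a "{0..\<delta>}"
      by unfold_locales (use geo \<delta> in auto)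
    have a_ends: "a 0 = p" "a \<delta> = q" using \<delta> by (auto simp: a_def)
    have a_in: "a s \<in> mseg p q" if "s \<in> {0..\<delta>}" for s
      using that \<delta> by (auto simp: a_def mseg_eq divide_le_eq_1)
    \<comment> \<open>As [p, q] is shortest, all of [p1, p2] projects to its start and all of
      [q1, q2] to its end.\<close>
    have left: "A.\<phi> u = 0" if "u \<in> mseg p1 p2" for u
    proof (rule A.\<phi>_eqI)
      fix s assume "s \<in> {0..\<delta>}"
      then show "dist u (a 0) \<le> dist u (a s)" unfolding a_ends
        using min[OF _ p(2)] mseg_convex[OF p(1) that] by (intro dist_shortest_end[of p u q] a_in) blast+
    qed (use \<delta> in auto)
    have right: "A.\<phi> u = \<delta>" if "u \<in> mseg q1 q2" for u
    proof (rule A.\<phi>_eqI)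
      fix s assume "s \<in> {0..\<delta>}"
      then have "a s \<in> mseg q p" using a_in mseg_commute by blast
      then show "dist u (a \<delta>) \<le> dist u (a s)" unfolding a_ends
        using min[OF p(1)] mseg_convex[OF p(2) that]
        by (intro dist_shortest_end[of q u p]) (auto simp: dist_commute)
    qed (use \<delta> in auto)
    \<comment> \<open>The segment is cut into \<open>L + 1\<close> pieces longer than 1, each with a
      dual curtain at its midpoint.\<close>
    define g where "g = \<delta> / (real L + 1)"
    have g: "1 < g" "(real L + 1) * g = \<delta>" using \<delta> by (auto simp: g_def)
    define k where "k i = dual_curtain a {0..\<delta>} (g / 2 + real i * g)" for i
    have range: "{g / 2 + real i * g - 1/2..g / 2 + real i * g + 1/2} \<subseteq> {0<..<\<delta>}" if "i < L + 1" for i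
    proof -
      have "real i * g \<le> real L * g" using that g by (intro mult_right_mono) auto
      moreover have "0 \<le> real i * g" using g by simp
      moreover have "real L * g + g = \<delta>" using g by (simp add: algebra_simps)
      ultimately have "0 < g / 2 + real i * g - 1/2" "g / 2 + real i * g + 1/2 < \<delta>" using g(1) by linarith+
      then show ?thesis by auto
    qed
    have int: "interior {0..\<delta>} = {0<..<\<delta>}" by simp
    have fact: "cat0_geodesic a {0..\<delta>}" by unfold_locales
    note chain = dual_curtain_chain[OF fact g(1), of "L + 1" "g / 2", unfolded int, OF range, folded k_def]
    \<comment> \<open>A connected set with points projecting to both ends takes every value of
      \<open>A.\<phi>\<close> in between. Such points are \<open>p1\<close>, \<open>q1\<close> in
      \<open>h\<close> and \<open>p2\<close>, \<open>q2\<close> in \<open>h'\<close>.\<close>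
    have meets: "k i \<inter> H \<noteq> {}" if "i < L + 1" "connected H" "u \<in> H" "v \<in> H"
      "u \<in> mseg p1 p2" "v \<in> mseg q1 q2" for i H u v
    proof -
      let ?r = "g / 2 + real i * g"
      have r: "0 < ?r" "?r < \<delta>" using subsetD[OF range[OF that(1)], of ?r] by auto
      have "connected (A.\<phi> ` H)" by (intro connected_continuous_image A.continuous_on_\<phi> that)
      then have "?r \<in> A.\<phi> ` H"
        using connectedD_interval[of "A.\<phi> ` H" 0 \<delta> ?r] r left[OF that(5)] right[OF that(6)]
          imageI[OF that(3), of A.\<phi>] imageI[OF that(4), of A.\<phi>] by simp
      then obtain x where "x \<in> H" "A.\<phi> x = ?r" by force
      then have "x \<in> k i \<inter> H" by (simp add: k_def in_dual_curtain)
      then show ?thesis by blast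
    qed
    have "chain_meets (k ` {..<L + 1}) h" "chain_meets (k ` {..<L + 1}) h'"
      unfolding chain_meets_def
      using meets[OF _ con(1) in_h] meets[OF _ con(2) in_h'] by (simp_all add: lessThan_iff)
    then have "card (k ` {..<L + 1}) \<le> L" using sep chain(1) unfolding L_separated_def by blast
    moreover have "card (k ` {..<L + 1}) = L + 1" using card_image[OF chain(2)] by simp
    ultimately show thesis by simp
  qed
qed

text \<open>Curtains and half spaces are not convex, so \<open>p\<close> is found between a crossing of the
  last curtain \<open>h'\<close> and the last preceding exit from the penultimate one \<open>h\<close>: there the geodesic
  stays beyond all the other curtains.\<close>

lemma L_separated_family_close:
  fixes e f u v :: 'a
  assumes fin: "finite c" and card: "2 < card c"
    and g: "\<And>h. h \<in> c \<Longrightarrow> curtain_fun h (g h) \<and> g h e < - 1/2 \<and> - 1/2 \<le> g h f \<and> h \<inter> mseg u v \<noteq> {}"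
    and sep: "\<And>h k. h \<in> c \<Longrightarrow> k \<in> c \<Longrightarrow> h \<noteq> k \<Longrightarrow> L_separated L h k"
  obtains p q where "p \<in> mseg e f" "q \<in> mseg u v" "dist p q \<le> real L + 1"
    "real (card c) \<le> dist e p + 2"
proof -
  define M where "M h = {x. g h x < - 1/2}" for h
  have disj: "h \<inter> k = {}" if "h \<in> c" "k \<in> c" "h \<noteq> k" for h k
    using sep[OF that] by (simp add: L_separated_def)
  \<comment> \<open>Seen from \<open>e\<close> the family is linearly ordered: \<open>k\<close>
    comes before \<open>h\<close> or lies beyond it. The positions of \<open>e\<close> and
    \<open>f\<close> fix the orientation of both curtain functions.\<close>
  have ordered: "M k \<subset> M h \<or> {x. g h x \<le> 1/2} \<subseteq> M k \<and> k \<subseteq> {x. g h x > 1/2}"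
    if hk: "h \<in> c" "k \<in> c" "h \<noteq> k" for h k
  proof -
    note gh = g[OF hk(1)] and gk = g[OF hk(2)] and d = disj[OF hk]
    have k: "connected k" "k \<noteq> {}" using gk by (auto simp: curtain_fun_def)
    then obtain y where y: "y \<in> k" by blast
    have ny: "y \<notin> h" using y d by blast
    show ?thesis
    proof (cases "g h y > 1/2")
      case True
      then have k': "k \<subseteq> {x. g h x > 1/2}"
        by (intro curtain_fun_side'[of h _ k y]) (use gh k y d True in blast)+
      moreover have "{x. g h x \<le> 1/2} \<subseteq> {x. g k x < - 1/2}"
        by (rule curtain_fun_lower_disjoint[of h "g h" k "g k" e]) (use gh gk d k' in simp_all)
      ultimately show ?thesis unfolding M_def by blast
    next
      case False
      then have "g h y < - 1/2" using ny curtain_fun_in[of h "g h" y] gh by (auto simp: abs_le_iff)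
      then have k': "k \<subseteq> M h" unfolding M_def
        by (intro curtain_fun_side[of h _ k y]) (use gh k y d \<open>g h y < - 1/2\<close> in blast)+
      have ch: "connected {x. g h x \<ge> - 1/2}" using gh by (simp add: curtain_fun_def)
      have dh: "{x. g h x \<ge> - 1/2} \<inter> k = {}" using k' by (auto simp: M_def)
      have "f \<notin> k" using dh gh by auto
      then have "g k f > 1/2" using gk curtain_fun_in[of k "g k" f] by (auto simp: abs_le_iff)
      then have "{x. g h x \<ge> - 1/2} \<subseteq> {x. g k x > 1/2}"
        by (intro curtain_fun_side'[of k _ _ f]) (use gh gk ch dh in simp_all)
      then have "g k x > 1/2" if "g h x \<ge> - 1/2" for x using that by blast
      then have "M k \<subseteq> M h" unfolding M_def using not_le by fastforce
      moreover have "y \<in> M h" "y \<notin> M k" using k' y gk curtain_fun_in[of k "g k" y] by (auto simp: M_def abs_le_iff)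
      ultimately show ?thesis by blast
    qed
  qed
  have "c \<noteq> {}" using card by auto
  \<comment> \<open>The largest side containing \<open>e\<close> belongs to the last curtain;
    \<open>h\<close> below is the last among the others.\<close>
  then obtain h' where h': "h' \<in> c" "\<And>k. k \<in> c \<Longrightarrow> \<not> M h' \<subset> M k"
    using finite_maximal_image[OF fin] by blast
  have "card (c - {h'}) \<noteq> 0" using card h'(1) by simp
  then have "finite (c - {h'})" "c - {h'} \<noteq> {}" using fin by auto
  then obtain h where h0: "h \<in> c - {h'}" "\<And>k. k \<in> c - {h'} \<Longrightarrow> \<not> M h \<subset> M k"
    by (rule finite_maximal_image[of "c - {h'}" M]) (rule that)
  then have h: "h \<in> c" "h \<noteq> h'" "\<And>k. k \<in> c \<Longrightarrow> k \<noteq> h' \<Longrightarrow> \<not> M h \<subset> M k" by simp_all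
  have strict: "M k \<subset> M h" if k: "k \<in> c" "k \<noteq> h" "k \<noteq> h'" for k
  proof (rule ccontr)
    assume "\<not> M k \<subset> M h"
    then have *: "{x. g h x \<le> 1/2} \<subseteq> M k" using ordered[OF h(1) k(1)] k(2) by blast
    obtain y where "y \<in> h" using g[OF h(1)] by (auto simp: curtain_fun_def)
    then have "g h y \<le> 1/2" "y \<notin> M h"
      using g[OF h(1)] curtain_fun_in[of h "g h" y] by (auto simp: M_def abs_le_iff)
    moreover have "M h \<subseteq> {x. g h x \<le> 1/2}" by (auto simp: M_def)
    ultimately have "M h \<subset> M k" using * by blast
    then show False using h(3)[OF k(1,3)] by simp
  qed
  have hh': "{x. g h x \<le> 1/2} \<subseteq> M h'" "h' \<subseteq> {x. g h x > 1/2}"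
    using ordered[OF h(1) h'(1) h(2)] h'(2)[OF h(1)] by blast+
  note gh = g[OF h(1)] and gh' = g[OF h'(1)]
  let ?f = "\<lambda>r. g h (gpt e f r)" and ?f' = "\<lambda>r. g h' (gpt e f r)"
  \<comment> \<open>Since \<open>f\<close> may lie in \<open>h'\<close> itself, -1/2 is the only
    boundary value certain to be attained.\<close>
  obtain t where t: "0 \<le> t" "t \<le> 1" "?f' t = - 1/2"
    using last_time_le[of 0 1 ?f' "- 1/2"] continuous_on_curtain_fun_gpt[of h' "g h'" 0 1 e f] gh' by auto
  have th': "gpt e f t \<in> h'" using t curtain_fun_in[of h' "g h'"] gh' by simp
  have "?f t > 1/2" using th' hh' by blast
  then have "\<exists>s. 0 \<le> s \<and> s \<le> t \<and> ?f s = 1/2 \<and> (\<forall>r\<in>{s..t}. 1/2 \<le> ?f r)"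
    using gh t by (intro last_time_le continuous_on_curtain_fun_gpt) auto
  then obtain s where s: "0 \<le> s" "s \<le> t" "?f s = 1/2" "\<And>r. r \<in> {s..t} \<Longrightarrow> 1/2 \<le> ?f r"
    by blast
  have sh: "gpt e f s \<in> h" using s curtain_fun_in[of h "g h"] gh by simp
  obtain q1 q2 where q: "q1 \<in> h" "q1 \<in> mseg u v" "q2 \<in> h'" "q2 \<in> mseg u v" using gh gh' by blast
  have "connected h" "connected h'" using gh gh' by (auto simp: curtain_fun_def)
  then obtain p q where pq: "p \<in> mseg (gpt e f s) (gpt e f t)" "q \<in> mseg q1 q2" "dist p q \<le> real L + 1"
    using L_separated_bridge[OF sep[OF h(1) h'(1) h(2)] _ _ sh q(1) th' q(3)] by blast
  obtain r where r: "s \<le> r" "r \<le> t" "p = gpt e f r" using pq(1) mseg_gpt[of s t e f] s t by auto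
  have gp: "1/2 \<le> g h p" using s(4) r by auto
  \<comment> \<open>The near sides of the remaining curtains lie in \<open>M h\<close>, which
    \<open>p\<close> has left, so all members but two separate \<open>e\<close> from
    \<open>p\<close>.\<close>
  have "real (card (c - {h, h'})) \<le> dist e p"
  proof (rule card_separating_le_dist[where g = g])
    fix k assume "k \<in> c - {h, h'}"
    then have k: "k \<in> c" "k \<noteq> h" "k \<noteq> h'" by auto
    have *: "{x. g k x \<le> 1/2} \<subseteq> M h" using ordered[OF k(1) h(1) k(2)] strict[OF k] by blast
    have "p \<notin> M h" using gp by (simp add: M_def)
    then have "g k p > 1/2" using * by force
    then show "curtain_fun k (g k) \<and> g k e < - 1/2 \<and> g k p > 1/2" using g[OF k(1)] by blast
  next
    fix k k' assume "k \<in> c - {h, h'}" "k' \<in> c - {h, h'}" "k \<noteq> k'"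
    then show "k \<inter> k' = {}" using disj by blast
  qed (use fin in simp)
  moreover have "card (c - {h, h'}) = card c - 2"
    using fin h h' by (simp add: card_Diff_subset)
  ultimately have "real (card c) \<le> dist e p + 2" using card by linarith
  moreover have "p \<in> mseg e f" using r s t by (auto simp: mseg_eq)
  moreover have "q \<in> mseg u v" using mseg_convex[OF q(2,4)] pq by auto
  ultimately show thesis using that pq(3) by blast
qed

end

section \<open>Persistent shadows give contraction\<close>

context cat0_geodesic
begin

text \<open>The bridge ends at a point of [e, f] of height at most \<open>L + 1\<close>. By
  \<open>near\<close> this point is within \<open>L + 1\<close> of \<open>e\<close>, and all but two
  of the curtains separate it from \<open>e\<close>.\<close>

lemma chain_card_step:
  assumes fin: "finite c" and uv: "s \<in> I" "t \<in> I"
    and g: "\<And>h. h \<in> c \<Longrightarrow> curtain_fun h (g h) \<and> g h e < - 1/2 \<and> - 1/2 \<le> g h f \<and> h \<inter> mseg (a s) (a t) \<noteq> {}"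
    and sep: "\<And>h k. h \<in> c \<Longrightarrow> k \<in> c \<Longrightarrow> h \<noteq> k \<Longrightarrow> L_separated L h k"
    and near: "\<And>p. p \<in> mseg e f \<Longrightarrow> \<eta> p \<le> real L + 1 \<Longrightarrow> dist e p \<le> real L + 1"
  shows "card c \<le> L + 3"
proof (cases "2 < card c")
  case True
  obtain p q where pq: "p \<in> mseg e f" "q \<in> mseg (a s) (a t)" "dist p q \<le> real L + 1"
    "real (card c) \<le> dist e p + 2"
    by (rule L_separated_family_close[OF fin True g sep])
  obtain r where "r \<in> I" "q = a r" using pq(2) mseg_sub[OF uv] by blast
  then have "\<eta> p \<le> real L + 1" using \<eta>_le[of r p] pq(3) by simp
  then show ?thesis using near[OF pq(1)] pq(4) by linarith
qed simp

lemma L_chain_card_bound: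
  assumes xy: "dist x y < \<eta> x" and c: "L_chain L c" "chain_separates c {a (\<phi> x)} {a (\<phi> y)}"
  shows "card c \<le> 3 * L + 9"
proof (cases "finite c")
  case True
  define u v where "u = a (\<phi> x)" and "v = a (\<phi> y)"
  have "\<forall>h\<in>c. \<exists>g. curtain_fun h g \<and> g u < - 1/2 \<and> g v > 1/2"
  proof
    fix h assume "h \<in> c"
    then have "curtain_separates h {u} {v}" using c(2) unfolding chain_separates_def u_def v_def by blast
    then obtain g where "curtain_fun h g" "{u} \<subseteq> {x. g x < - 1/2}" "{v} \<subseteq> {x. g x > 1/2}"
      by (rule curtain_separatesE)
    then show "\<exists>g. curtain_fun h g \<and> g u < - 1/2 \<and> g v > 1/2" by blast
  qed
  from bchoice[OF this] obtain g where
    g: "\<And>h. h \<in> c \<Longrightarrow> curtain_fun h (g h)" "\<And>h. h \<in> c \<Longrightarrow> g h u < - 1/2" "\<And>h. h \<in> c \<Longrightarrow> g h v > 1/2"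
    by blast
  have sep: "L_separated L h k" if "h \<in> c" "k \<in> c" "h \<noteq> k" for h k
    using c(1) that unfolding L_chain_def by blast
  have meet: "h \<inter> mseg u v \<noteq> {}" if "h \<in> c" for h
  proof -
    have "connected (g h ` mseg u v)"
      by (intro connected_continuous_image curtain_fun_continuous[OF g(1)] connected_mseg that)
    then have "0 \<in> g h ` mseg u v"
      using connectedD_interval[of "g h ` mseg u v" "g h u" "g h v" 0] g[OF that] by simp
    then obtain w where "w \<in> mseg u v" "g h w = 0" by force
    then have "w \<in> h" using curtain_fun_in[OF g(1)[OF that], of w] by simp
    then show ?thesis using \<open>w \<in> mseg u v\<close> by blast
  qed
  have near: "dist (a (\<phi> w)) p \<le> real L + 1" if "p \<in> mseg (a (\<phi> w)) w" "\<eta> p \<le> real L + 1" for p w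
  proof -
    have "\<phi> p = \<phi> w" using that(1) by (intro \<phi>_mseg) (simp add: mseg_commute)
    then show ?thesis using that(2) by (simp add: \<eta>_def dist_commute)
  qed
  \<comment> \<open>A curtain in neither of the first two classes has \<open>x\<close> on the side
    of \<open>u\<close> and \<open>y\<close> on the side of \<open>v\<close>, so it is crossed by
    [x, y]. The classes may overlap.\<close>
  let ?cx = "{h \<in> c. - 1/2 \<le> g h x}" and ?cy = "{h \<in> c. g h y \<le> 1/2}"
  let ?cz = "{h \<in> c. g h x < - 1/2 \<and> 1/2 < g h y}"
  have "card ?cx \<le> L + 3"
    by (rule chain_card_step[of ?cx "\<phi> x" "\<phi> y" g u x L])
      (use True g meet sep near[of _ x] in \<open>auto simp: u_def v_def\<close>)
  moreover have "card ?cy \<le> L + 3"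
    by (rule chain_card_step[of ?cy "\<phi> x" "\<phi> y" "\<lambda>h x. - g h x" v y L])
      (use True g meet sep near[of _ y] in \<open>auto simp: u_def v_def intro: curtain_fun_uminus\<close>)
  moreover have "card ?cz \<le> L + 3"
  \<comment> \<open>The segment is read from \<open>y\<close> to \<open>x\<close> with signs
    reversed: as \<open>\<eta> x\<close> exceeds its length, points of small height on it are near
    \<open>y\<close>.\<close>
  proof (rule chain_card_step[of ?cz "\<phi> x" "\<phi> y" "\<lambda>h x. - g h x" y x L])
    fix p assume p: "p \<in> mseg y x" "\<eta> p \<le> real L + 1"
    have "dist y p + dist p x < \<eta> x" using p(1) xy by (simp add: mseg_def dist_commute)
    then show "dist y p \<le> real L + 1" using \<eta>_lipschitz[of x p] p(2) by (simp add: dist_commute)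
  qed (use True g meet sep in \<open>auto simp: u_def v_def intro: curtain_fun_uminus\<close>)
  moreover have "card c \<le> card ?cx + card ?cy + card ?cz"
  proof -
    have "c = ?cx \<union> ?cy \<union> ?cz" by auto
    then have "card c = card (?cx \<union> ?cy \<union> ?cz)" by simp
    also have "\<dots> \<le> card (?cx \<union> ?cy) + card ?cz" by (rule card_Un_le)
    also have "\<dots> \<le> card ?cx + card ?cy + card ?cz" using card_Un_le[of ?cx ?cy] by simp
    finally show ?thesis .
  qed
  ultimately show ?thesis by linarith
qed simp

end

section \<open>Upper and lower bounds for the series \<open>dhat\<close>\<close>

lemma summable_inverse_Suc_squares: "summable (\<lambda>n. 1 / real (Suc n) ^ 2)"
  using inverse_power_summable[of 2, where 'a = real] summable_Suc_iff[of "\<lambda>n. inverse (real n ^ 2)"]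
  by (simp add: inverse_eq_divide)

definition "inverse_squares_sum = (\<Sum>n. 1 / real (Suc n) ^ 2)"

lemma inverse_squares_sum_pos: "0 < inverse_squares_sum"
  unfolding inverse_squares_sum_def using summable_inverse_Suc_squares by (rule suminf_pos) simp

lemma dhat_term_le:
  assumes "0 \<le> d" "d \<le> B"
  shows "d / real (Suc n) ^ 3 \<le> B * (1 / real (Suc n) ^ 2)"
proof -
  have "d / real (Suc n) ^ 3 \<le> B / real (Suc n) ^ 2"
    using assms by (intro frac_le power_increasing) auto
  then show ?thesis by simp
qed

context cat0
begin

lemma dhat_summable: "summable (\<lambda>n. real (L_dist (Suc n) x (y::'a)) / real (Suc n) ^ 3)"
proof (rule summable_comparison_test')
  show "summable (\<lambda>n. (1 + dist x y) * (1 / real (Suc n) ^ 2))"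
    by (intro summable_mult summable_inverse_Suc_squares)
  fix n :: nat assume "0 \<le> n"
  show "norm (real (L_dist (Suc n) x y) / real (Suc n) ^ 3) \<le> (1 + dist x y) * (1 / real (Suc n) ^ 2)"
    using dhat_term_le[OF _ L_dist_bound[of "Suc n" x y], of n] by simp
qed

lemma dhat_ge:
  fixes x y :: 'a
  assumes "1 \<le> L"
  shows "real (L_dist L x y) / real L ^ 3 \<le> dhat x y"
proof -
  have "(\<Sum>n\<in>{L - 1}. real (L_dist (Suc n) x y) / real (Suc n) ^ 3) \<le> dhat x y"
    unfolding dhat_def by (intro sum_le_suminf dhat_summable) auto
  then show ?thesis using assms by simp
qed

text \<open>Every term is at most \<open>B / real (Suc n) ^ 2\<close>. Up to \<open>L\<close> this
  follows from monotonicity of \<open>L_dist\<close> in its index; beyond \<open>L\<close> one of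
  the three factors of the denominator supplies \<open>1 / L\<close>.\<close>

lemma dhat_le:
  fixes x y :: 'a
  assumes "1 \<le> L"
  shows "dhat x y \<le> inverse_squares_sum * (real (L_dist L x y) + (1 + dist x y) / real L)"
proof -
  define B where "B = real (L_dist L x y) + (1 + dist x y) / real L"
  have "real (L_dist (Suc n) x y) / real (Suc n) ^ 3 \<le> B * (1 / real (Suc n) ^ 2)" for n
  proof (cases "Suc n \<le> L")
    case True
    then have "real (L_dist (Suc n) x y) \<le> B"
      using L_dist_mono[OF True, of x y] unfolding B_def by (simp add: add_increasing2)
    then show ?thesis by (intro dhat_term_le) auto
  next
    case False
    have "real (L_dist (Suc n) x y) / real (Suc n) \<le> (1 + dist x y) / real L"
      using L_dist_bound[of "Suc n" x y] False assms by (intro frac_le) auto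
    also have "\<dots> \<le> B" by (simp add: B_def)
    finally have "real (L_dist (Suc n) x y) / real (Suc n) / real (Suc n) ^ 2 \<le> B / real (Suc n) ^ 2"
      by (intro divide_right_mono) auto
    then show ?thesis by (simp add: power3_eq_cube power2_eq_square mult.assoc)
  qed
  then have "dhat x y \<le> (\<Sum>n. B * (1 / real (Suc n) ^ 2))"
    unfolding dhat_def
    by (intro suminf_le dhat_summable summable_mult summable_inverse_Suc_squares)
  also have "\<dots> = B * inverse_squares_sum"
    unfolding inverse_squares_sum_def by (intro suminf_mult summable_inverse_Suc_squares)
  finally show ?thesis by (simp add: B_def mult.commute)
qed

end

section \<open>Sublinear functions: subadditivity and arbitrarily small slope\<close>

context
  fixes \<kappa> :: "real \<Rightarrow> real"
  assumes \<kappa>: "sublinear_function \<kappa>"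
begin

lemma sublinear_ge_1: "0 \<le> t \<Longrightarrow> 1 \<le> \<kappa> t"
  using \<kappa> by (simp add: sublinear_function_def)

lemma sublinear_mono: "0 \<le> s \<Longrightarrow> s \<le> t \<Longrightarrow> \<kappa> s \<le> \<kappa> t"
  using \<kappa> by (auto simp: sublinear_function_def mono_on_def)

lemma sublinear_scale:
  assumes "0 \<le> t" "0 \<le> r" "r \<le> 1"
  shows "r * \<kappa> t \<le> \<kappa> (r * t)"
proof -
  have "r * \<kappa> t + (1 - r) * \<kappa> 0 \<le> \<kappa> (r *\<^sub>R t + (1 - r) *\<^sub>R 0)"
  proof -
    have "\<forall>x\<in>{0..}. \<forall>y\<in>{0..}. \<forall>u\<ge>0. \<forall>v\<ge>0. u + v = 1 \<longrightarrow>
        u * \<kappa> x + v * \<kappa> y \<le> \<kappa> (u *\<^sub>R x + v *\<^sub>R y)"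
      using \<kappa> unfolding sublinear_function_def concave_on_iff by blast
    from this[rule_format, of t 0 r "1 - r"] show ?thesis using assms by simp
  qed
  moreover have "0 \<le> (1 - r) * \<kappa> 0" using sublinear_ge_1[of 0] assms by simp
  ultimately show ?thesis by simp
qed

text \<open>Concavity and a positive value at 0 give \<open>sublinear_scale\<close>, applied to the
  two fractions of \<open>s + t\<close>.\<close>

lemma sublinear_add:
  assumes "0 \<le> s" "0 \<le> t"
  shows "\<kappa> (s + t) \<le> \<kappa> s + \<kappa> t"
proof (cases "s + t = 0")
  case True
  then have "s = 0" "t = 0" using assms by auto
  then show ?thesis using sublinear_ge_1[of 0] by simp
next
  case False
  then have st: "0 < s + t" using assms by simp
  then have "s / (s + t) * \<kappa> (s + t) \<le> \<kappa> s" "t / (s + t) * \<kappa> (s + t) \<le> \<kappa> t"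
    using sublinear_scale[of "s + t" "s / (s + t)"] sublinear_scale[of "s + t" "t / (s + t)"] assms
    by auto
  moreover have "s / (s + t) * \<kappa> (s + t) + t / (s + t) * \<kappa> (s + t) = \<kappa> (s + t)"
    using st by (simp add: add_divide_distrib[symmetric] distrib_right[symmetric])
  ultimately show ?thesis by linarith
qed

lemma sublinear_affine_bound:
  assumes "0 < \<epsilon>"
  obtains M where "0 \<le> M" "\<And>w. 0 \<le> w \<Longrightarrow> \<kappa> w \<le> \<epsilon> * w + M"
proof -
  have "((\<lambda>t. \<kappa> t / t) \<longlongrightarrow> 0) at_top"
    using \<kappa> by (simp add: sublinear_function_def sublinear_growth_def)
  then have "\<forall>\<^sub>F t in at_top. \<kappa> t / t < \<epsilon>" using assms by (rule order_tendstoD)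
  then obtain W where W: "\<And>t. W \<le> t \<Longrightarrow> \<kappa> t / t < \<epsilon>" by (auto simp: eventually_at_top_linorder)
  define V where "V = max W 1"
  show thesis
  proof (rule that[of "\<kappa> V"])
    have "0 \<le> V" by (simp add: V_def)
    then show "0 \<le> \<kappa> V" using sublinear_ge_1[of V] by linarith
    fix w :: real assume w: "0 \<le> w"
    show "\<kappa> w \<le> \<epsilon> * w + \<kappa> V"
    proof (cases "w \<le> V")
      case True
      then show ?thesis using sublinear_mono[OF w True] w assms by (simp add: add_increasing)
    next
      case False
      then have "\<kappa> w / w < \<epsilon>" "0 < w" using W[of w] by (auto simp: V_def)
      then show ?thesis using \<open>0 \<le> \<kappa> V\<close> by (simp add: pos_divide_less_eq)
    qed
  qed
qed

end

context cat0
begin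

lemma persistent_shadow_imp_contracting:
  fixes b :: "real \<Rightarrow> 'a"
  assumes \<kappa>: "sublinear_function \<kappa>" and b: "geodesic_ray_from o' b" and p: "persistent_shadow \<kappa> b"
  shows "contracting_ray o' (\<lambda>t. \<kappa> t ^ 2) b"
proof -
  note ge1 = sublinear_ge_1[OF \<kappa>] and mono = sublinear_mono[OF \<kappa>] and add = sublinear_add[OF \<kappa>]
  interpret B: cat0_geodesic X b "{0..}"
    by unfold_locales (use b in \<open>auto simp: geodesic_ray_from_def is_interval_ci\<close>)
  have b0: "b 0 = o'" using b by (simp add: geodesic_ray_from_def)
  obtain C where C: "0 < C" "\<And>s t. 0 \<le> s \<Longrightarrow> s < t \<Longrightarrow> C * ((t - s) / \<kappa> t) - C \<le> dhat (b s) (b t)"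
    using p unfolding persistent_shadow_def by blast
  define Z where "Z = inverse_squares_sum"
  have Z: "0 < Z" by (simp add: Z_def inverse_squares_sum_pos)
  define A where "A = 2 / C * (2 * C + Z * (13 + 6 * Z / C))"
  have A: "0 < A" using Z C by (simp add: A_def add_pos_pos)
  have bound: "t - s \<le> A * \<kappa> t ^ 2"
    if st: "0 \<le> s" "s < t" and N: "\<And>L c. L_chain L c \<Longrightarrow> chain_separates c {b s} {b t} \<Longrightarrow> card c \<le> 3 * L + 9"
    for s t
  proof -
    define k where "k = \<kappa> t"
    have k: "1 \<le> k" using ge1[of t] st by (simp add: k_def)
    \<comment> \<open>Then \<open>Z / L \<le> C / (2 * k)\<close>: up to a constant the tail of the
      series absorbs only half of the lower bound \<open>C * ((t - s) / k)\<close>, while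
      \<open>L\<close> stays of order \<open>k\<close>.\<close>
    define L where "L = nat \<lceil>2 * Z * k / C\<rceil>"
    have pos: "0 < 2 * Z * k / C" using Z k C by simp
    have L: "2 * Z * k / C \<le> real L" "real L \<le> 2 * Z * k / C + 1" "1 \<le> L"
      using pos unfolding L_def by linarith+
    have d: "dist (b s) (b t) = t - s" using B.dist_a[of s t] st by simp
    then have ne: "b s \<noteq> b t" using st by auto
    obtain c where c: "L_chain L c" "chain_separates c {b s} {b t}" "L_dist L (b s) (b t) = 1 + card c"
      using ne by (rule L_dist_attained)
    have "real (L_dist L (b s) (b t)) \<le> 10 + 3 * real L" using N[OF c(1,2)] c(3) by simp
    also have "\<dots> \<le> 13 + 6 * Z * k / C" using L(2) by simp
    also have "\<dots> \<le> k * (13 + 6 * Z / C)" using k by (simp add: algebra_simps)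
    finally have LD: "real (L_dist L (b s) (b t)) \<le> k * (13 + 6 * Z / C)" .
    have ZL: "Z / real L \<le> C / (2 * k)"
      using L(1,3) k C by (simp add: field_simps)
    have "C * ((t - s) / k) - C \<le> dhat (b s) (b t)" using C(2)[OF st] by (simp add: k_def)
    also have "\<dots> \<le> Z * (real (L_dist L (b s) (b t)) + (1 + (t - s)) / real L)"
      using dhat_le[OF L(3), of "b s" "b t"] by (simp add: Z_def d)
    also have "\<dots> = Z * real (L_dist L (b s) (b t)) + (1 + (t - s)) * (Z / real L)"
      by (simp add: distrib_left mult.commute add_divide_distrib)
    also have "\<dots> \<le> Z * (k * (13 + 6 * Z / C)) + (1 + (t - s)) * (C / (2 * k))"
      using LD ZL Z st by (intro add_mono mult_left_mono) auto
    finally have *: "C * ((t - s) / k) - C \<le> Z * (k * (13 + 6 * Z / C)) + (1 + (t - s)) * (C / (2 * k))" .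
    have e: "C * ((t - s) / k) = 2 * ((t - s) * (C / (2 * k)))" "(1 + (t - s)) * (C / (2 * k)) = C / (2 * k) + (t - s) * (C / (2 * k))"
      using k by (simp_all add: field_simps)
    have "C / (2 * k) \<le> C" using k C by (simp add: divide_le_eq)
    moreover have "C \<le> C * k" using k C by simp
    ultimately have "(t - s) * (C / (2 * k)) \<le> 2 * (C * k) + Z * (k * (13 + 6 * Z / C))"
      using *[unfolded e] by linarith
    also have "\<dots> = k * (2 * C + Z * (13 + 6 * Z / C))" by (simp add: algebra_simps)
    finally have "(t - s) * (C / (2 * k)) * (2 * k / C) \<le> k * (2 * C + Z * (13 + 6 * Z / C)) * (2 * k / C)"
      using k C by (intro mult_right_mono) auto
    then have "t - s \<le> k * (2 * C + Z * (13 + 6 * Z / C)) * (2 * k / C)" using k C by simp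
    also have "\<dots> = A * k ^ 2" using C by (simp add: A_def power2_eq_square field_simps)
    finally show ?thesis by (simp add: k_def)
  qed
  \<comment> \<open>As \<open>dist x w\<close> is less than \<open>dist o' x\<close>, the point
    \<open>w\<close> is at most twice as far from \<open>o'\<close> as \<open>x\<close>.
    Subadditivity doubles \<open>\<kappa>\<close>, and squaring gives the factor 4.\<close>
  have step: "\<bar>B.\<phi> x - B.\<phi> w\<bar> \<le> 4 * A * \<kappa> (dist o' x) ^ 2" if xw: "dist x w < B.\<eta> x" for x w
  proof -
    have "dist (b (B.\<phi> x)) (b (B.\<phi> w)) = \<bar>B.\<phi> x - B.\<phi> w\<bar>" by (intro B.dist_a B.\<phi>_in)
    have \<phi>0: "B.\<phi> o' = 0" using B.\<phi>_a[of 0] b0 by simp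
    have nx: "B.\<phi> x \<le> dist o' x" "B.\<phi> w \<le> dist o' w"
      using B.\<phi>_lipschitz[of x o'] B.\<phi>_lipschitz[of w o'] \<phi>0 by (auto simp: dist_commute)
    have "dist x w < dist o' x" using xw B.\<eta>_le[of 0 x] b0 by (simp add: dist_commute)
    then have nw: "dist o' w \<le> 2 * dist o' x" using dist_triangle[of o' w x] by simp
    let ?t = "max (B.\<phi> x) (B.\<phi> w)"
    have \<phi>pos: "0 \<le> B.\<phi> x" "0 \<le> B.\<phi> w" using B.\<phi>_in[of x] B.\<phi>_in[of w] by auto
    have "\<kappa> ?t \<le> \<kappa> (dist o' x + dist o' x)" using nx nw \<phi>pos by (intro mono) auto
    also have "\<dots> \<le> 2 * \<kappa> (dist o' x)" using add[of "dist o' x" "dist o' x"] by simp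
    finally have \<kappa>t: "\<kappa> ?t \<le> 2 * \<kappa> (dist o' x)" .
    have "0 \<le> ?t" using \<phi>pos by simp
    then have "0 \<le> \<kappa> ?t" using ge1[of ?t] by linarith
    have "\<bar>B.\<phi> x - B.\<phi> w\<bar> \<le> A * \<kappa> ?t ^ 2"
    proof (cases "B.\<phi> x" "B.\<phi> w" rule: linorder_cases)
      case equal
      then show ?thesis using A by simp
    next
      case less
      have "B.\<phi> w - B.\<phi> x \<le> A * \<kappa> (B.\<phi> w) ^ 2"
        by (rule bound[OF \<phi>pos(1) less]) (rule B.L_chain_card_bound[OF xw])
      then show ?thesis using less by (simp add: max_def)
    next
      case greater
      have "B.\<phi> x - B.\<phi> w \<le> A * \<kappa> (B.\<phi> x) ^ 2"
      proof (rule bound[OF \<phi>pos(2) greater])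
        fix L c assume c: "L_chain L c" "chain_separates c {b (B.\<phi> w)} {b (B.\<phi> x)}"
        then have "chain_separates c {b (B.\<phi> x)} {b (B.\<phi> w)}"
          unfolding chain_separates_def using curtain_separates_sym by blast
        then show "card c \<le> 3 * L + 9" using B.L_chain_card_bound[OF xw c(1)] by simp
      qed
      then show ?thesis using greater by (simp add: max_def)
    qed
    also have "\<dots> \<le> A * (2 * \<kappa> (dist o' x)) ^ 2"
      using A \<kappa>t \<open>0 \<le> \<kappa> ?t\<close> by (intro mult_left_mono power_mono) auto
    finally show ?thesis by (simp add: power_mult_distrib)
  qed
  show ?thesis unfolding contracting_ray_def
  \<comment> \<open>Two points of the ball are compared through its centre, which doubles
    \<open>4 * A\<close>; the extra 1 makes the inequality strict.\<close>
  proof (intro exI[of _ "8 * A + 1"] conjI allI impI)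
    show "0 \<le> 8 * A + 1" using A by simp
    fix x and R :: real assume R: "0 < R" "ball x R \<inter> b ` {0..} = {}"
    define K where "K = \<kappa> (dist o' x) ^ 2"
    have K: "1 \<le> K" using ge1[of "dist o' x"] by (simp add: K_def)
    have "b (B.\<phi> x) \<notin> ball x R" using R(2) B.\<phi>_in[of x] by blast
    then have R\<eta>: "R \<le> B.\<eta> x" by (simp add: B.\<eta>_def)
    have "dist p q \<le> 8 * A * K"
      if "p \<in> closest_proj (b ` {0..}) ` ball x R" "q \<in> closest_proj (b ` {0..}) ` ball x R" for p q
    proof -
      obtain w w' where w: "w \<in> ball x R" "w' \<in> ball x R" "p = b (B.\<phi> w)" "q = b (B.\<phi> w')"
        using \<open>p \<in> _\<close> \<open>q \<in> _\<close> unfolding B.closest_proj_eq by blast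
      have "\<bar>B.\<phi> x - B.\<phi> w\<bar> \<le> 4 * A * K" "\<bar>B.\<phi> x - B.\<phi> w'\<bar> \<le> 4 * A * K"
        using step[of x w] step[of x w'] w R\<eta> by (simp_all add: K_def)
      moreover have "dist p q = \<bar>B.\<phi> w - B.\<phi> w'\<bar>" unfolding w by (intro B.dist_a B.\<phi>_in)
      ultimately show ?thesis by linarith
    qed
    then have "diameter (closest_proj (b ` {0..}) ` ball x R) \<le> 8 * A * K"
      using R(1) by (auto simp: diameter_def intro!: cSUP_least)
    also have "\<dots> < (8 * A + 1) * K" using K by (simp add: algebra_simps)
    finally show "diameter (closest_proj (b ` {0..}) ` ball x R) < (8 * A + 1) * \<kappa> (dist o' x) ^ 2"
      by (simp add: K_def)
  qed
qed

end

section \<open>Contraction gives persistent shadows\<close>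

context cat0_geodesic
begin

text \<open>Each of six equal pieces has length at most 5R/6, less than the height of its starting
  point, so the contraction hypothesis applies to every piece.\<close>

lemma \<phi>_steps:
  assumes E: "\<And>z w. dist z w < \<eta> z \<Longrightarrow> \<bar>\<phi> z - \<phi> w\<bar> \<le> E (\<eta> z)" and mono: "mono E"
    and R: "0 < R" and len: "dist x y \<le> 5 * R"
    and low: "\<And>z. z \<in> mseg x y \<Longrightarrow> R \<le> \<eta> z \<and> \<eta> z \<le> 6 * R"
  shows "\<bar>\<phi> x - \<phi> y\<bar> \<le> 6 * E (6 * R)"
proof -
  define z where "z i = gpt x y (real i / 6)" for i :: nat
  have step: "\<bar>\<phi> (z i) - \<phi> (z (Suc i))\<bar> \<le> E (6 * R)" if "i < 6" for i
  proof -
    have "z i \<in> mseg x y" using that by (auto simp: z_def mseg_eq)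
    then have l: "R \<le> \<eta> (z i)" "\<eta> (z i) \<le> 6 * R" using low by auto
    have "dist (z i) (z (Suc i)) = \<bar>real i / 6 - real (Suc i) / 6\<bar> * dist x y"
      unfolding z_def using that by (intro dist_gpt_gpt) auto
    also have "real i / 6 - real (Suc i) / 6 = - (1 / 6)" by (simp add: field_simps)
    also have "\<bar>- (1 / 6)\<bar> * dist x y < R" using len R by simp
    finally have "\<bar>\<phi> (z i) - \<phi> (z (Suc i))\<bar> \<le> E (\<eta> (z i))" using l(1) by (intro E) simp
    also have "\<dots> \<le> E (6 * R)" using mono l(2) by (rule monoD)
    finally show ?thesis .
  qed
  have "\<bar>\<phi> (z 0) - \<phi> (z 6)\<bar> \<le> 6 * E (6 * R)"
    using step[of 0] step[of 1] step[of 2] step[of 3] step[of 4] step[of 5]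
    by (simp add: eval_nat_numeral)
  then show ?thesis by (simp add: z_def)
qed

text \<open>The geodesic starts at its lowest point \<open>m\<close>. The point at height \<open>3R\<close> above the
  projection of \<open>x\<close> and the point of \<open>[x, m]\<close> at the same distance from \<open>x\<close> are less than \<open>3R\<close>
  apart, so contraction compares their projections in one step, however far away \<open>x\<close> is; the rest of
  \<open>[x, m]\<close> has length at most \<open>5R\<close>.\<close>

lemma projection_from_lowest_point:
  assumes E: "\<And>z w. dist z w < \<eta> z \<Longrightarrow> \<bar>\<phi> z - \<phi> w\<bar> \<le> E (\<eta> z)" and mono: "mono E"
    and R: "0 < R" "7 * E (6 * R) < R"
    and m: "\<eta> m = R" and low: "\<And>z. z \<in> mseg x m \<Longrightarrow> R \<le> \<eta> z"
  shows "\<bar>\<phi> x - \<phi> m\<bar> \<noteq> R"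
proof
  assume q: "\<bar>\<phi> x - \<phi> m\<bar> = R"
  define H l where "H = \<eta> x" and "l = dist x m"
  have dm: "dist (a (\<phi> x)) (a (\<phi> m)) = R" using dist_a[of "\<phi> x" "\<phi> m"] q by simp
  have \<pi>m: "dist (a (\<phi> x)) m \<le> 2 * R"
    using dist_triangle[of "a (\<phi> x)" m "a (\<phi> m)"] dm m by (simp add: \<eta>_def dist_commute)
  have lH: "l \<le> H + 2 * R" "H \<le> l + R"
    using dist_triangle[of x m "a (\<phi> x)"] \<pi>m \<eta>_lipschitz[of x m] m
    by (auto simp: l_def H_def \<eta>_def)
  have high: "\<eta> z \<le> R + dist z m" for z using \<eta>_lipschitz[of z m] m by simp
  obtain A where A: "A \<in> mseg x m" "dist A m \<le> 5 * R" "\<bar>\<phi> x - \<phi> A\<bar> \<le> E (6 * R)"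
  proof (cases "H \<le> 3 * R")
    case True
    have "\<bar>\<phi> x - \<phi> x\<bar> \<le> E (\<eta> x)" using low[of x] R by (intro E) auto
    also have "\<dots> \<le> E (6 * R)" using mono True R by (intro monoD[OF mono]) (simp add: H_def)
    finally show thesis using that[of x] True lH by (simp add: l_def)
  next
    case False
    \<comment> \<open>Height \<open>3 * R\<close> exceeds the bound \<open>2 * R\<close> on
      \<open>dist (a (\<phi> x)) m\<close>, which \<open>chord\<close> passes on to
      \<open>dist y A\<close>. The remaining length is at most (H + 2R) - (H - 3R) = 5R.\<close>
    define D where "D = H - 3 * R"
    have D: "0 < D" "D \<le> H" "D \<le> l" using False lH R by (auto simp: D_def)
    define y A where "y = gpt x (a (\<phi> x)) (D / H)" and "A = gpt x m (D / l)"
    have H: "dist x (a (\<phi> x)) = H" by (simp add: H_def \<eta>_def)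
    have H0: "0 < H" "0 < l" using D by auto
    have "y \<in> mseg x (a (\<phi> x))" using D H0 by (auto simp: y_def mseg_eq divide_le_eq_1)
    then have \<phi>y: "\<phi> y = \<phi> x" by (rule \<phi>_mseg)
    have "\<eta> y = dist y (a (\<phi> x))" by (simp add: \<eta>_def \<phi>y)
    also have "\<dots> = (1 - D / H) * H"
      unfolding y_def using D H0 dist_gpt_right[of "D / H" x "a (\<phi> x)"] by (simp add: H)
    also have "\<dots> = H - D" using H0 by (simp add: left_diff_distrib)
    also have "\<dots> = 3 * R" by (simp add: D_def)
    finally have \<eta>y: "\<eta> y = 3 * R" .
    have "a (\<phi> x) \<noteq> x" using H H0(1) by auto
    then have "dist y A \<le> dist (a (\<phi> x)) m"
      using chord[of "a (\<phi> x)" x m D] H0 D unfolding y_def A_def H l_def by auto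
    also have "\<dots> < \<eta> y" using \<pi>m R unfolding \<eta>y by simp
    finally have "\<bar>\<phi> y - \<phi> A\<bar> \<le> E (\<eta> y)" by (rule E)
    also have "\<dots> \<le> E (6 * R)" using R unfolding \<eta>y by (intro monoD[OF mono]) simp
    finally have 1: "\<bar>\<phi> x - \<phi> A\<bar> \<le> E (6 * R)" by (simp add: \<phi>y)
    have "dist A m = (1 - D / l) * l"
      unfolding A_def l_def[symmetric] using D H0 dist_gpt_right[of "D / l" x m] by (simp add: l_def)
    also have "\<dots> = l - D" using H0 by (simp add: left_diff_distrib)
    also have "\<dots> \<le> 5 * R" using lH by (simp add: D_def)
    finally show thesis using that[of A] 1 D H0 by (auto simp: A_def mseg_eq divide_le_eq_1)
  qed
  have "\<bar>\<phi> A - \<phi> m\<bar> \<le> 6 * E (6 * R)"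
  proof (rule \<phi>_steps[OF E mono R(1) A(2)])
    fix z assume z: "z \<in> mseg A m"
    then have "z \<in> mseg x m" using mseg_convex[OF A(1) mseg_ends(2)] by blast
    moreover have "dist z m \<le> 5 * R" using z A(2) zero_le_dist[of A z]
      unfolding mseg_def mem_Collect_eq by linarith
    ultimately show "R \<le> \<eta> z \<and> \<eta> z \<le> 6 * R" using low[of z] high[of z] by simp
  qed
  \<comment> \<open>One contraction step from \<open>x\<close> to \<open>A\<close> and six from
    \<open>A\<close> to \<open>m\<close> account for the factor 7.\<close>
  then show False using A(3) q R(2) by linarith
qed

text \<open>If \<open>[x, y]\<close> stayed above height \<open>R\<close>, then moving \<open>y\<close> down towards its projection would at
  some moment produce a geodesic whose lowest point is exactly at height \<open>R\<close>.\<close>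

lemma geodesic_meets_neighbourhood:
  assumes E: "\<And>z w. dist z w < \<eta> z \<Longrightarrow> \<bar>\<phi> z - \<phi> w\<bar> \<le> E (\<eta> z)" and mono: "mono E"
    and R: "0 < R" "7 * E (6 * R) < R"
    and far: "2 * R \<le> \<bar>\<phi> x - \<phi> y\<bar>"
  shows "\<exists>z\<in>mseg x y. \<eta> z \<le> R"
proof (rule ccontr)
  assume "\<not> ?thesis"
  then have above: "R < \<eta> z" if "z \<in> mseg x y" for z using that by force
  define p where "p s = gpt (a (\<phi> y)) y s" for s
  define F where "F st = \<eta> (gpt x (p (fst st)) (snd st))" for st
  let ?Q = "{0..1::real} \<times> {0..1::real}"
  \<comment> \<open>This serves twice: continuity makes the sublevel set of \<open>F\<close>
    compact, and the explicit rate in the first parameter is used in \<open>Fge\<close>.\<close>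
  have Lip: "\<bar>F st - F st'\<bar> \<le> dist (a (\<phi> y)) y * \<bar>fst st - fst st'\<bar> + dist x (p (fst st')) * \<bar>snd st - snd st'\<bar>"
    if "st \<in> ?Q" "st' \<in> ?Q" for st st'
  proof -
    let ?g = "\<lambda>st. gpt x (p (fst st)) (snd st)"
    have "dist (?g st) (?g st') \<le> dist (?g st) (gpt x (p (fst st')) (snd st)) + dist (gpt x (p (fst st')) (snd st)) (?g st')"
      by (rule dist_triangle)
    also have "\<dots> \<le> snd st * dist (p (fst st)) (p (fst st')) + \<bar>snd st - snd st'\<bar> * dist x (p (fst st'))"
      using that by (intro add_mono chord_same_fraction) (auto simp: dist_gpt_gpt)
    also have "\<dots> \<le> 1 * dist (p (fst st)) (p (fst st')) + \<bar>snd st - snd st'\<bar> * dist x (p (fst st'))"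
      using that by (intro add_mono mult_right_mono) auto
    also have "dist (p (fst st)) (p (fst st')) = \<bar>fst st - fst st'\<bar> * dist (a (\<phi> y)) y"
      unfolding p_def using that by (intro dist_gpt_gpt) auto
    finally have "dist (?g st) (?g st') \<le> dist (a (\<phi> y)) y * \<bar>fst st - fst st'\<bar> + dist x (p (fst st')) * \<bar>snd st - snd st'\<bar>"
      by (simp add: mult.commute)
    then show ?thesis
      using \<eta>_lipschitz[of "?g st" "?g st'"] \<eta>_lipschitz[of "?g st'" "?g st"]
      by (simp add: F_def dist_commute)
  qed
  have contF: "continuous_on ?Q F"
    unfolding continuous_on_def
  proof
    fix st assume st: "st \<in> ?Q"
    let ?B = "\<lambda>st'. dist (a (\<phi> y)) y * \<bar>fst st' - fst st\<bar> + dist x (p (fst st)) * \<bar>snd st' - snd st\<bar>"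
    have "(?B \<longlongrightarrow> ?B st) (at st within ?Q)" by (intro tendsto_intros)
    then have B0: "(?B \<longlongrightarrow> 0) (at st within ?Q)" by simp
    have "\<forall>\<^sub>F st' in at st within ?Q. norm (F st' - F st) \<le> ?B st'"
      unfolding eventually_at_filter using Lip st by (auto intro!: always_eventually)
    then have "((\<lambda>st'. F st' - F st) \<longlongrightarrow> 0) (at st within ?Q)" using B0 by (rule Lim_null_comparison)
    then show "(F \<longlongrightarrow> F st) (at st within ?Q)" by (rule LIM_zero_cancel)
  qed
  define S where "S = fst ` (?Q \<inter> F -` {..R})"
  have "closed (?Q \<inter> F -` {..R})" by (intro continuous_closed_preimage contF closed_Times) auto
  moreover have "bounded (?Q \<inter> F -` {..R})"
    by (rule bounded_subset[of ?Q]) (auto intro: bounded_Times)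
  ultimately have "compact (?Q \<inter> F -` {..R})" by (simp add: compact_eq_bounded_closed)
  then have "compact S" unfolding S_def by (intro compact_continuous_image continuous_intros)
  moreover have "0 \<in> S"
  proof -
    have "F (0, 1) = 0" by (simp add: F_def p_def \<eta>_def)
    then show ?thesis using R unfolding S_def by (intro image_eqI[of _ _ "(0,1)"]) auto
  qed
  \<comment> \<open>The highest position on the way from the foot of \<open>y\<close> up to
    \<open>y\<close> from which the geodesic to \<open>x\<close> still reaches height at most
    \<open>R\<close>.\<close>
  ultimately obtain s where s: "s \<in> S" "\<And>s'. s' \<in> S \<Longrightarrow> s' \<le> s"
    using compact_attains_sup[of S] by blast
  then obtain t where st: "0 \<le> s" "s \<le> 1" "0 \<le> t" "t \<le> 1" "F (s, t) \<le> R" by (auto simp: S_def)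
  have "s \<noteq> 1"
  proof
    assume "s = 1"
    then have "\<eta> (gpt x y t) \<le> R" using st by (simp add: F_def p_def)
    moreover have "gpt x y t \<in> mseg x y" using st by (auto simp: mseg_eq)
    ultimately show False using above by force
  qed
  then have s1: "s < 1" using st by simp
  \<comment> \<open>A value below \<open>R\<close> would stay at most \<open>R\<close> for slightly
    larger \<open>s\<close>, against maximality.\<close>
  have Fge: "R \<le> F (s, t)" if t: "0 \<le> t" "t \<le> 1" for t
  proof (rule ccontr)
    assume lt: "\<not> R \<le> F (s, t)"
    define K where "K = dist (a (\<phi> y)) y"
    define d where "d = min (1 - s) ((R - F (s, t)) / (K + 1))"
    have K: "0 \<le> K" "0 < K + 1" by (auto simp: K_def add_nonneg_pos)
    have d: "0 < d" "d \<le> 1 - s" "d \<le> (R - F (s, t)) / (K + 1)" using s1 lt K by (auto simp: d_def)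
    have "F (s + d, t) - F (s, t) \<le> K * d"
      using Lip[of "(s + d, t)" "(s, t)"] d st t by (simp add: K_def)
    also have "\<dots> \<le> (K + 1) * d" using d by simp
    also have "\<dots> \<le> R - F (s, t)" using d(3) K by (simp add: pos_le_divide_eq mult.commute)
    finally have "F (s + d, t) \<le> R" by simp
    then have "s + d \<in> S" unfolding S_def using d st t by (intro image_eqI[of _ _ "(s + d, t)"]) auto
    then show False using s(2) d(1) by force
  qed
  define y' m where "y' = p s" and "m = gpt x y' t"
  have "y' \<in> mseg y (a (\<phi> y))"
    unfolding mseg_commute[of y "a (\<phi> y)"] unfolding mseg_eq y'_def p_def using st by auto
  then have \<phi>y': "\<phi> y' = \<phi> y" by (rule \<phi>_mseg)
  have ge: "R \<le> \<eta> z" if "z \<in> mseg x y'" for z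
    using that Fge unfolding mseg_eq F_def y'_def by auto
  have m_in: "m \<in> mseg x y'" using st by (auto simp: m_def mseg_eq)
  have m: "\<eta> m = R" using ge[OF m_in] st(5) by (simp add: F_def m_def y'_def)
  \<comment> \<open>The ends project to parameters at least \<open>2 * R\<close> apart, so one of
    them is displaced by at least \<open>R\<close> from \<open>m\<close>. Shortening the geodesic at
    that end makes the displacement exactly \<open>R\<close>.\<close>
  obtain w where w: "w \<in> mseg x y'" "R \<le> \<bar>\<phi> w - \<phi> m\<bar>"
  proof (cases "R \<le> \<bar>\<phi> x - \<phi> m\<bar>")
    case False
    then have "R \<le> \<bar>\<phi> y' - \<phi> m\<bar>" using far \<phi>y' by linarith
    then show thesis using that[of y'] by simp
  qed (use that[of x] in simp)
  have "connected ((\<lambda>z. \<bar>\<phi> z - \<phi> m\<bar>) ` mseg m w)"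
    by (intro connected_continuous_image continuous_intros continuous_on_\<phi> connected_mseg)
  then have "R \<in> (\<lambda>z. \<bar>\<phi> z - \<phi> m\<bar>) ` mseg m w"
    using connectedD_interval[of "(\<lambda>z. \<bar>\<phi> z - \<phi> m\<bar>) ` mseg m w" 0 "\<bar>\<phi> w - \<phi> m\<bar>" R] w R(1)
      imageI[OF mseg_ends(1), of "\<lambda>z. \<bar>\<phi> z - \<phi> m\<bar>" m w] imageI[OF mseg_ends(2), of "\<lambda>z. \<bar>\<phi> z - \<phi> m\<bar>" w m]
    by simp
  then obtain x' where x': "x' \<in> mseg m w" "\<bar>\<phi> x' - \<phi> m\<bar> = R" by force
  have "mseg x' m \<subseteq> mseg x y'"
    using mseg_convex[OF _ m_in] mseg_convex[OF m_in w(1)] x'(1) by blast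
  then show False using projection_from_lowest_point[OF E mono R m, of x'] ge x'(2) by blast
qed

end

context cat0
begin

text \<open>A ball missing the segment may still meet the ray, so contraction need not apply at
  \<open>z\<close>. If the projections of \<open>z\<close> and \<open>w\<close> to the segment
  differ, some \<open>x\<close> on [z, w] projects on the ray to the segment foot of
  \<open>z\<close>, and \<open>w\<close> is closer to \<open>x\<close> than the ray is. The argument
  of \<open>\<kappa>\<close> comes from d(o', z) \<le> T + \<eta> and d(z, x) \<le> \<eta>, with
  \<eta> the height of \<open>z\<close>.\<close>

lemma contracting_on_segment:
  fixes b :: "real \<Rightarrow> 'a"
  assumes \<kappa>: "sublinear_function \<kappa>" and b: "geodesic_ray_from o' b"
    and C: "0 \<le> C" and contr: "\<And>x R. 0 < R \<Longrightarrow> ball x R \<inter> b ` {0..} = {} \<Longrightarrow>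
        diameter (closest_proj (b ` {0..}) ` ball x R) < C * \<kappa> (dist o' x)"
    and r: "0 \<le> r1" "r1 \<le> r2" "r2 \<le> T"
    and seg: "cat0_geodesic b {r1..r2}"
    and zw: "dist z w < cat0_geodesic.\<eta> b {r1..r2} z"
  shows "\<bar>gpar b {r1..r2} z - gpar b {r1..r2} w\<bar> \<le> C * \<kappa> (T + 2 * cat0_geodesic.\<eta> b {r1..r2} z)"
proof -
  interpret B: cat0_geodesic X b "{0..}"
    by unfold_locales (use b in \<open>auto simp: geodesic_ray_from_def is_interval_ci\<close>)
  interpret J: cat0_geodesic X b "{r1..r2}" by fact
  have b0: "b 0 = o'" using b by (simp add: geodesic_ray_from_def)
  have clamp: "J.\<phi> x = max r1 (min r2 (B.\<phi> x))" for x
    by (rule B.gpar_restrict) (use r in auto)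
  have basic: "\<bar>B.\<phi> x - B.\<phi> w\<bar> \<le> C * \<kappa> (dist o' x)" if xw: "dist x w < B.\<eta> x" for x w
  proof -
    have R: "0 < B.\<eta> x" using xw zero_le_dist[of x w] by linarith
    have disj: "ball x (B.\<eta> x) \<inter> b ` {0..} = {}" using B.\<eta>_le[of _ x] by force
    let ?P = "closest_proj (b ` {0..}) ` ball x (B.\<eta> x)"
    have proj: "b (B.\<phi> u) \<in> ?P" if "dist x u < B.\<eta> x" for u
      using that by (auto simp flip: B.closest_proj_eq)
    have "bounded ?P" unfolding bounded_def
    proof (intro exI ballI)
      fix q assume "q \<in> ?P"
      then obtain u where u: "dist x u < B.\<eta> x" "q = b (B.\<phi> u)" unfolding B.closest_proj_eq by auto
      have "dist (b (B.\<phi> x)) q = \<bar>B.\<phi> x - B.\<phi> u\<bar>" unfolding u(2) by (intro B.dist_a B.\<phi>_in)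
      then show "dist (b (B.\<phi> x)) q \<le> B.\<eta> x" using B.\<phi>_lipschitz[of x u] u by simp
    qed
    then have "dist (b (B.\<phi> x)) (b (B.\<phi> w)) \<le> diameter ?P"
      using proj[of x] proj[of w] xw R by (intro diameter_bounded_bound) auto
    also have "\<dots> \<le> C * \<kappa> (dist o' x)" using contr[OF R disj] by simp
    finally show ?thesis using B.dist_a[OF B.\<phi>_in B.\<phi>_in, of x w] by simp
  qed
  have "J.\<phi> z \<in> {r1..r2}" by (rule J.\<phi>_in)
  then have \<phi>z: "0 \<le> J.\<phi> z" "J.\<phi> z \<le> T" using r by auto
  have "dist o' z \<le> dist (b 0) (b (J.\<phi> z)) + dist (b (J.\<phi> z)) z" using dist_triangle[of o' z] by (simp add: b0)
  also have "\<dots> = J.\<phi> z + J.\<eta> z" using B.dist_a[of 0 "J.\<phi> z"] \<phi>z by (simp add: J.\<eta>_def dist_commute)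
  finally have nz: "dist o' z \<le> T + J.\<eta> z" using \<phi>z by simp
  have mono: "C * \<kappa> (dist o' x) \<le> C * \<kappa> (T + 2 * J.\<eta> z)" if "dist o' x \<le> T + 2 * J.\<eta> z" for x
    using sublinear_mono[OF \<kappa>, of "dist o' x"] that C by (intro mult_left_mono) auto
  have outside: "\<bar>B.\<phi> x - B.\<phi> w\<bar> \<le> C * \<kappa> (T + 2 * J.\<eta> z)"
    if x: "x \<in> mseg z w" "B.\<phi> x = J.\<phi> z" for x
  proof -
    have "dist x w < B.\<eta> x"
      using zw x dist_triangle[of z "b (J.\<phi> z)" x] by (simp add: B.\<eta>_def J.\<eta>_def mseg_def)
    then have "\<bar>B.\<phi> x - B.\<phi> w\<bar> \<le> C * \<kappa> (dist o' x)" by (rule basic)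
    also have "\<dots> \<le> C * \<kappa> (T + 2 * J.\<eta> z)"
    proof (rule mono)
      have "dist z x \<le> J.\<eta> z" using x(1) zw zero_le_dist[of x w] unfolding mseg_def mem_Collect_eq by linarith
      then show "dist o' x \<le> T + 2 * J.\<eta> z" using nz dist_triangle[of o' x z] by simp
    qed
    finally show ?thesis .
  qed
  have E0: "0 \<le> C * \<kappa> (T + 2 * J.\<eta> z)"
    using C sublinear_ge_1[OF \<kappa>, of "T + 2 * J.\<eta> z"] r by (simp add: add_nonneg_nonneg)
  have con: "connected (B.\<phi> ` mseg z w)"
    by (intro connected_continuous_image B.continuous_on_\<phi> connected_mseg)
  have ivt: "\<exists>x\<in>mseg z w. B.\<phi> x = v" if "min (B.\<phi> z) (B.\<phi> w) \<le> v" "v \<le> max (B.\<phi> z) (B.\<phi> w)" for v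
  proof -
    have "v \<in> B.\<phi> ` mseg z w"
      using connectedD_interval[OF con, of "B.\<phi> z" "B.\<phi> w" v] connectedD_interval[OF con, of "B.\<phi> w" "B.\<phi> z" v] that
      by (auto simp: min_def max_def split: if_splits)
    then show ?thesis by blast
  qed
  show ?thesis
  proof (cases "J.\<phi> z = J.\<phi> w")
    case False
    then have "min (B.\<phi> z) (B.\<phi> w) \<le> J.\<phi> z \<and> J.\<phi> z \<le> max (B.\<phi> z) (B.\<phi> w)"
      using r unfolding clamp by (auto simp: min_def max_def split: if_splits)
    then obtain x where x: "x \<in> mseg z w" "B.\<phi> x = J.\<phi> z" using ivt by blast
    have "\<bar>J.\<phi> z - J.\<phi> w\<bar> \<le> \<bar>J.\<phi> z - B.\<phi> w\<bar>"
      using \<open>J.\<phi> z \<in> {r1..r2}\<close> unfolding clamp[of w] by (auto simp: min_def max_def)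
    then show ?thesis using outside[OF x] x by simp
  qed (use E0 in simp)
qed

text \<open>With R = K \<kappa>(t) this is the condition 7 E(6R) < R for E(v) = C \<kappa>(t + 2v).
  \<open>K\<close> occurs on both sides, but \<kappa> has arbitrarily small slope at large scale, so
  the inner \<open>K\<close> uses up only half of the right-hand side.\<close>

lemma contraction_scale:
  assumes \<kappa>: "sublinear_function \<kappa>" and C: "0 \<le> C"
  obtains K where "1 \<le> K" "\<And>t. 0 \<le> t \<Longrightarrow> 7 * (C * \<kappa> (t + 12 * (K * \<kappa> t))) < K * \<kappa> t"
proof -
  \<comment> \<open>As 168 = 2 * 7 * 12, the term with \<open>\<epsilon>\<close> becomes half of
    \<open>K * k\<close>; \<open>K\<close> is then chosen so that the other terms amount to
    \<open>(K - 1) / 2 * k\<close>.\<close>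
  define \<epsilon> where "\<epsilon> = 1 / (168 * (C + 1))"
  have \<epsilon>: "0 < \<epsilon>" using C by (simp add: \<epsilon>_def)
  obtain M where M: "0 \<le> M" "\<And>w. 0 \<le> w \<Longrightarrow> \<kappa> w \<le> \<epsilon> * w + M"
    using sublinear_affine_bound[OF \<kappa> \<epsilon>] by blast
  define K where "K = 14 * (C + 1) * (1 + M) + 1"
  have K: "1 \<le> K" using C M by (simp add: K_def)
  show thesis
  proof (rule that[OF K])
    fix t :: real assume t: "0 \<le> t"
    define k where "k = \<kappa> t"
    have k: "1 \<le> k" using sublinear_ge_1[OF \<kappa> t] by (simp add: k_def)
    have "\<kappa> (t + 12 * (K * k)) \<le> k + \<kappa> (12 * (K * k))"
      using sublinear_add[OF \<kappa> t, of "12 * (K * k)"] K k by (simp add: k_def)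
    also have "\<dots> \<le> k + (\<epsilon> * (12 * (K * k)) + M)" using M(2)[of "12 * (K * k)"] K k by simp
    also have "\<dots> \<le> k + (\<epsilon> * (12 * (K * k)) + M * k)" using M k mult_left_mono[of 1 k M] by simp
    finally have "7 * ((C + 1) * \<kappa> (t + 12 * (K * k))) \<le> 7 * ((C + 1) * (k + (\<epsilon> * (12 * (K * k)) + M * k)))"
      using C by (intro mult_left_mono) auto
    also have "\<dots> = 7 * (C + 1) * (1 + M) * k + 84 * ((C + 1) * \<epsilon>) * (K * k)" by (simp add: algebra_simps)
    also have "(C + 1) * \<epsilon> = 1 / 168" using C by (simp add: \<epsilon>_def)
    also have "7 * (C + 1) * (1 + M) = (K - 1) / 2" by (simp add: K_def)
    also have "(K - 1) / 2 * k + 84 * (1 / 168) * (K * k) < K * k" using k by (simp add: field_simps)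
    finally have "7 * ((C + 1) * \<kappa> (t + 12 * (K * k))) < K * k" .
    moreover have "0 \<le> \<kappa> (t + 12 * (K * k))" using sublinear_ge_1[OF \<kappa>, of "t + 12 * (K * k)"] t K k by simp
    ultimately show "7 * (C * \<kappa> (t + 12 * (K * \<kappa> t))) < K * \<kappa> t"
      unfolding k_def[symmetric] by (simp add: algebra_simps)
  qed
qed

lemma dual_curtains_separated:
  fixes b :: "real \<Rightarrow> 'a"
  assumes b: "geodesic_ray_from o' b" and R: "1 \<le> R"
    and r: "0 \<le> r" "G = 4 * R + 2" "r + G \<le> r'"
    and near: "\<And>x y. 2 * R \<le> \<bar>gpar b {r..r + G} x - gpar b {r..r + G} y\<bar> \<Longrightarrow>
        \<exists>z\<in>mseg x y. cat0_geodesic.\<eta> b {r..r + G} z \<le> R"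
    and c: "curtain_chain c" "chain_meets c (dual_curtain b {0..} r)" "chain_meets c (dual_curtain b {0..} r')"
    and M: "6 * R + 2 < real M"
  shows "finite c \<and> card c \<le> M + 1"
proof -
  interpret B: cat0_geodesic X b "{0..}"
    by unfold_locales (use b in \<open>auto simp: geodesic_ray_from_def is_interval_ci\<close>)
  have G: "0 < G" using r R by simp
  interpret J: cat0_geodesic X b "{r..r + G}"
    by (rule B.cat0_geodesic_sub) (use r G in auto)
  have clamp: "J.\<phi> x = max r (min (r + G) (B.\<phi> x))" for x
    by (rule B.gpar_restrict) (use r G in auto)
  have ex: "\<exists>z\<in>k. J.\<eta> z \<le> R" if k: "k \<in> c" for k
  proof -
    have "curtain k" using c(1) k unfolding curtain_chain_def by blast
    have "k \<inter> dual_curtain b {0..} r \<noteq> {}" "k \<inter> dual_curtain b {0..} r' \<noteq> {}"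
      using c(2,3) k unfolding chain_meets_def by blast+
    then obtain x y where x: "x \<in> k" "\<bar>B.\<phi> x - r\<bar> \<le> 1/2" and y: "y \<in> k" "\<bar>B.\<phi> y - r'\<bar> \<le> 1/2"
      unfolding disjoint_iff in_dual_curtain by blast
    obtain p q where pq: "mseg x p \<subseteq> k" "mseg q y \<subseteq> k" "dist p q \<le> 1"
      using \<open>curtain k\<close> x(1) y(1) by (rule curtain_path)
    have "J.\<phi> x \<le> r + 1/2" using x(2) unfolding clamp by linarith
    moreover have "r + G - 1/2 \<le> J.\<phi> y" using y(2) r(3) G unfolding clamp by linarith
    moreover have "\<bar>J.\<phi> p - J.\<phi> q\<bar> \<le> 1" using J.\<phi>_lipschitz[of p q] pq(3) by simp
    \<comment> \<open>The projections of \<open>x\<close> and \<open>y\<close> differ by at least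
      \<open>G - 1\<close>. The jump from \<open>p\<close> to \<open>q\<close> costs 1 more, and
      \<open>G - 2 = 4 * R\<close> is shared by the two segments inside \<open>k\<close>.\<close>
    ultimately have "2 * R \<le> \<bar>J.\<phi> x - J.\<phi> p\<bar> \<or> 2 * R \<le> \<bar>J.\<phi> q - J.\<phi> y\<bar>" using r(2) by linarith
    then show ?thesis
    proof
      assume "2 * R \<le> \<bar>J.\<phi> x - J.\<phi> p\<bar>"
      from near[OF this] show ?thesis using pq(1) by blast
    next
      assume "2 * R \<le> \<bar>J.\<phi> q - J.\<phi> y\<bar>"
      from near[OF this] show ?thesis using pq(2) by blast
    qed
  qed
  then have "\<forall>k\<in>c. \<exists>z. z \<in> k \<and> J.\<eta> z \<le> R" by blast
  from bchoice[OF this] obtain z where z: "\<And>k. k \<in> c \<Longrightarrow> z k \<in> k" "\<And>k. k \<in> c \<Longrightarrow> J.\<eta> (z k) \<le> R" by blast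
  show ?thesis
  proof (rule chain_indices_bound[OF c(1) z(1)])
    fix k k' assume k: "k \<in> c" "k' \<in> c"
    let ?u = "b (J.\<phi> (z k))" and ?v = "b (J.\<phi> (z k'))"
    \<comment> \<open>Down, along and up again: \<open>R + G + R = 6 * R + 2\<close>. The middle
      part is at most \<open>G\<close> because the projection is to the short segment.\<close>
    have "dist (z k) (z k') \<le> dist (z k) ?u + dist ?u ?v + dist ?v (z k')"
      using dist_triangle[of "z k" "z k'" ?u] dist_triangle[of ?u "z k'" ?v] by simp
    also have "dist ?u ?v = \<bar>J.\<phi> (z k) - J.\<phi> (z k')\<bar>" by (intro J.dist_a J.\<phi>_in)
    also have "\<dots> \<le> G" using J.\<phi>_in[of "z k"] J.\<phi>_in[of "z k'"] unfolding atLeastAtMost_iff by linarith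
    finally have "dist (z k) (z k') \<le> dist (z k) ?u + G + dist ?v (z k')" by simp
    moreover have "dist (z k) ?u \<le> R" "dist ?v (z k') \<le> R"
      using z(2)[OF k(1)] z(2)[OF k(2)] by (simp_all add: J.\<eta>_def dist_commute)
    ultimately show "dist (z k) (z k') < real M" using M r(2) by linarith
  qed
qed

text \<open>Curtains dual to \<open>b\<close> at spacing of order \<open>\<kappa> t\<close> are \<open>L\<close>-separated with \<open>L\<close> of order
  \<open>\<kappa> t\<close>; dividing their number by \<open>L ^ 3\<close> gives the exponent 4.\<close>

lemma contracting_imp_persistent_shadow:
  fixes b :: "real \<Rightarrow> 'a"
  assumes \<kappa>: "sublinear_function \<kappa>" and b: "geodesic_ray_from o' b" and contr: "contracting_ray o' \<kappa> b"
  shows "persistent_shadow (\<lambda>t. \<kappa> t ^ 4) b"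
proof -
  interpret B: cat0_geodesic X b "{0..}"
    by unfold_locales (use b in \<open>auto simp: geodesic_ray_from_def is_interval_ci\<close>)
  obtain C where C: "0 \<le> C" "\<And>x R. 0 < R \<Longrightarrow> ball x R \<inter> b ` {0..} = {} \<Longrightarrow>
        diameter (closest_proj (b ` {0..}) ` ball x R) < C * \<kappa> (dist o' x)"
    using contr unfolding contracting_ray_def by blast
  obtain K where K: "1 \<le> K" "\<And>t. 0 \<le> t \<Longrightarrow> 7 * (C * \<kappa> (t + 12 * (K * \<kappa> t))) < K * \<kappa> t"
    using contraction_scale[OF \<kappa> C(1)] by blast
  \<comment> \<open>From \<open>G \<le> 6 * R\<close> for the spacing, \<open>L \<le> 11 * R\<close>
    for the separation, and \<open>R = K * \<kappa> t\<close>.\<close>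
  define c0 where "c0 = 1 / (6 * 11 ^ 3 * K ^ 4)"
  have c0: "0 < c0" using K by (simp add: c0_def)
  have main: "c0 * ((t - s) / \<kappa> t ^ 4) \<le> dhat (b s) (b t)" if st: "0 \<le> s" "s < t" for s t
  proof -
    define R G where "R = K * \<kappa> t" and "G = 4 * R + 2"
    have k: "1 \<le> \<kappa> t" using sublinear_ge_1[OF \<kappa>, of t] st by simp
    then have R: "1 \<le> R" using K mult_mono[of 1 K 1 "\<kappa> t"] by (simp add: R_def)
    have G: "6 \<le> G" "G \<le> 6 * R" using R by (auto simp: G_def)
    define M L where "M = nat \<lceil>6 * R + 3\<rceil>" and "L = M + 1"
    have M: "6 * R + 2 < real M" "real M \<le> 6 * R + 4" using R unfolding M_def by linarith+
    have L: "real L \<le> 11 * R" "1 \<le> L" using M R by (auto simp: L_def)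
    define N where "N = nat \<lfloor>(t - s) / G\<rfloor>"
    have tG: "0 \<le> (t - s) / G" using st G by simp
    have N: "real N \<le> (t - s) / G" "(t - s) / G \<le> real N + 1" using tG unfolding N_def by linarith+
    have NG: "real N * G \<le> t - s" using N(1) G by (simp add: pos_le_divide_eq)
    have pos: "s + 1 + real i * G + G \<le> t + 1" if "i < N" for i
    proof -
      have "(real i + 1) * G \<le> real N * G" using that G by (intro mult_right_mono) auto
      then show ?thesis using NG by (simp add: algebra_simps)
    qed
    \<comment> \<open>The offset 1 puts the first curtain strictly beyond \<open>b s\<close>;
      \<open>pos\<close> and \<open>6 \<le> G\<close> keep the last one strictly before
      \<open>b t\<close>.\<close>
    define h where "h i = dual_curtain b {0..} (s + 1 + real i * G)" for i
    have sep: "L_separated L (h i) (h j)" if ij: "i < j" "j < N" for i j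
    proof -
      let ?r = "s + 1 + real i * G" and ?r' = "s + 1 + real j * G"
      have ij': "?r + G \<le> ?r'"
      proof -
        have "(real i + 1) * G \<le> real j * G" using ij G by (intro mult_right_mono) auto
        then show ?thesis by (simp add: algebra_simps)
      qed
      have r0: "0 \<le> ?r" using st G by simp
      have seg: "cat0_geodesic b {?r..?r + G}" by (rule B.cat0_geodesic_sub) (use r0 G in auto)
      interpret J: cat0_geodesic X b "{?r..?r + G}" by fact
      have rT: "?r + G \<le> t" using ij' pos[OF ij(2)] G by simp
      \<comment> \<open>\<open>\<kappa>\<close> is controlled only on nonnegative arguments;
        \<open>max 0 v\<close> makes \<open>E\<close> monotone on all reals.\<close>
      define E where "E v = C * \<kappa> (t + 2 * max 0 v)" for v
      have E: "\<bar>J.\<phi> z - J.\<phi> w\<bar> \<le> E (J.\<eta> z)" if "dist z w < J.\<eta> z" for z w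
        unfolding E_def using contracting_on_segment[OF \<kappa> b C r0 _ rT seg that] G by simp
      have Emono: "mono E" unfolding E_def
        using st C(1) by (intro monoI mult_left_mono sublinear_mono[OF \<kappa>]) auto
      have ER: "7 * E (6 * R) < R" using K(2)[of t] st R by (simp add: E_def R_def)
      have near: "\<exists>z\<in>mseg x y. J.\<eta> z \<le> R" if "2 * R \<le> \<bar>J.\<phi> x - J.\<phi> y\<bar>" for x y
        using J.geodesic_meets_neighbourhood[OF E Emono _ ER that] R by simp
      have "h i \<inter> h j = {}"
      proof (rule ccontr)
        assume "h i \<inter> h j \<noteq> {}"
        then obtain x where "\<bar>B.\<phi> x - ?r\<bar> \<le> 1/2" "\<bar>B.\<phi> x - ?r'\<bar> \<le> 1/2" by (auto simp: h_def in_dual_curtain)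
        then show False using ij' G by linarith
      qed
      moreover have "finite c \<and> card c \<le> L" if "curtain_chain c" "chain_meets c (h i)" "chain_meets c (h j)" for c
        using dual_curtains_separated[OF b R r0 G_def ij' near that[unfolded h_def] M(1)] by (simp add: L_def)
      ultimately show ?thesis unfolding L_separated_def by blast
    qed
    have int: "{s + 1 + real i * G - 1/2..s + 1 + real i * G + 1/2} \<subseteq> interior {0..}" for i
    proof -
      have "0 \<le> real i * G" using G by simp
      then show ?thesis using st by auto
    qed
    have fact: "cat0_geodesic b {0..}" by unfold_locales
    have G1: "1 < G" using G by simp
    note chain = dual_curtain_chain[OF fact G1 int, of N, folded h_def]
    have sym: "L_separated L (h i) (h j)" if "i < N" "j < N" "i \<noteq> j" for i j
      using sep[of i j] sep[of j i] that unfolding L_separated_def by (metis Int_commute linorder_neqE_nat)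
    have "L_chain L (h ` {..<N})"
      unfolding L_chain_def using chain(1) sym by auto
    moreover have "chain_separates (h ` {..<N}) {b s} {b t}"
      unfolding chain_separates_def
    proof
      fix k assume "k \<in> h ` {..<N}"
      then obtain i where i: "i < N" "k = h i" by auto
      have "0 \<le> real i * G" using G by simp
      then have "s < s + 1 + real i * G - 1/2" "s + 1 + real i * G + 1/2 < t"
        using pos[OF i(1)] G by linarith+
      moreover have "B.\<phi> (b s) = s" "B.\<phi> (b t) = t" using st by auto
      ultimately have "B.\<phi> (b s) < s + 1 + real i * G - 1/2" "s + 1 + real i * G + 1/2 < B.\<phi> (b t)"
        by simp_all
      then show "curtain_separates k {b s} {b t}"
        unfolding curtain_separates_def i h_def
        using dual_curtain_halves[OF fact int, of i] by blast
    qed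
    moreover have "b s \<noteq> b t" using B.dist_a[of s t] st by auto
    ultimately have "1 + card (h ` {..<N}) \<le> L_dist L (b s) (b t)" by (intro L_dist_ge)
    then have "1 + N \<le> L_dist L (b s) (b t)" using card_image[OF chain(2)] by simp
    \<comment> \<open>The summand 1 in \<open>L_dist\<close> makes up for the rounding in
      \<open>N\<close>.\<close>
    then have "(t - s) / G \<le> real (L_dist L (b s) (b t))" using N(2) by linarith
    then have "(t - s) / (6 * R) / (11 * R) ^ 3 \<le> real (L_dist L (b s) (b t)) / real L ^ 3"
    proof (intro frac_le)
      assume "(t - s) / G \<le> real (L_dist L (b s) (b t))"
      moreover have "(t - s) / (6 * R) \<le> (t - s) / G" using G st by (intro divide_left_mono) auto
      ultimately show "(t - s) / (6 * R) \<le> real (L_dist L (b s) (b t))" by simp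
      show "real L ^ 3 \<le> (11 * R) ^ 3" using L by (intro power_mono) auto
    qed (use L in auto)
    also have "\<dots> \<le> dhat (b s) (b t)" by (rule dhat_ge[OF L(2)])
    also have "(t - s) / (6 * R) / (11 * R) ^ 3 = c0 * ((t - s) / \<kappa> t ^ 4)"
      by (simp add: c0_def R_def power_mult_distrib power4_eq_xxxx power3_eq_cube)
    finally show ?thesis .
  qed
  show ?thesis unfolding persistent_shadow_def
  proof (intro exI[of _ c0] conjI allI impI c0)
    fix s t :: real assume "0 \<le> s \<and> s < t"
    then show "dhat (b s) (b t) \<ge> c0 * ((t - s) / \<kappa> t ^ 4) - c0" using main[of s t] c0 by simp
  qed
qed

end

theorem theoremD:
  fixes \<oo> :: "'a::metric_space"
    and \<kappa> :: "real \<Rightarrow> real"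
    and b :: "real \<Rightarrow> 'a"
  assumes "CAT0_space TYPE('a)"
    and "sublinear_function \<kappa>"
    and "geodesic_ray_from \<oo> b"
    and "dhat_infinite_diameter (b ` {0..})"
  shows "(contracting_ray \<oo> \<kappa> b \<and> sublinear_growth (\<lambda>t. \<kappa> t ^ 4) \<longrightarrow>
            persistent_shadow (\<lambda>t. \<kappa> t ^ 4) b) \<and>
         (persistent_shadow \<kappa> b \<and> sublinear_growth (\<lambda>t. \<kappa> t ^ 2) \<longrightarrow>
            contracting_ray \<oo> (\<lambda>t. \<kappa> t ^ 2) b)"
proof -
  interpret cat0 "TYPE('a)" by unfold_locales (rule assms(1))
  show ?thesis
    using contracting_imp_persistent_shadow persistent_shadow_imp_contracting assms(2,3) by blast
qed

end
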